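(* Let $R$ be a nonzero simple ring. The following statements are equivalent: (1) $R$ is right isoartinian; (2) $R\cong \mathbb{M}_n(D)$ for some $n\ge 1$ and some simple principal right ideal domain $D$. Moreover, if in addition the ring $D$ in (2) is a division ring, then $R$ is simple artinian (hence right artinian and right noetherian).
   Context: Rings are associative with unity. A right $R$-module $M$ is isoartinian if for every descending chain $M\ge M_1\ge M_2\ge\cdots$ of submodules of $M$ there is $n$ such that $M_i\cong M_n$ for all $i\ge n$. A ring $R$ is right isoartinian if the right module $R_R$ is isoartinian. $\mathbb{M}_n(D)$ is the ring of $n\times n$ matrices over $D$. A principal right ideal domain is a (not necessarily commutative) domain in which every right ideal is principal; simple means having no two-sided ideals other than zero and the whole ring. *)

theory Defs
  imports "HOL-Algebra.Algebra" "Jordan_Normal_Form.Matrix"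
begin

section \<open>Modules over a not necessarily commutative ring\<close>

text \<open>
  The locale \<^locale>\<open>module\<close> requires a commutative ring of scalars. Its record type is reused here
  for right modules over an arbitrary ring: the field \<^const>\<open>smult\<close> is always written with the
  scalar first, so that in a right module \<open>r \<odot> x\<close> stands for the product of \<open>x\<close> by \<open>r\<close> on the right,
  and the associativity law reads \<open>(x r) s = x (r s)\<close>.
\<close>

locale right_module = R?: ring R + M?: abelian_group M
  for R :: "('a, 'm) ring_scheme" (structure) and M :: "('a, 'b, 'k) module_scheme" (structure) +
  assumes smult_closed:
      "\<lbrakk> r \<in> carrier R; x \<in> carrier M \<rbrakk> \<Longrightarrow> r \<odot>\<^bsub>M\<^esub> x \<in> carrier M"
    and smult_add_scalar:
      "\<lbrakk> r \<in> carrier R; s \<in> carrier R; x \<in> carrier M \<rbrakk> \<Longrightarrow>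
        (r \<oplus>\<^bsub>R\<^esub> s) \<odot>\<^bsub>M\<^esub> x = r \<odot>\<^bsub>M\<^esub> x \<oplus>\<^bsub>M\<^esub> s \<odot>\<^bsub>M\<^esub> x"
    and smult_add:
      "\<lbrakk> r \<in> carrier R; x \<in> carrier M; y \<in> carrier M \<rbrakk> \<Longrightarrow>
        r \<odot>\<^bsub>M\<^esub> (x \<oplus>\<^bsub>M\<^esub> y) = r \<odot>\<^bsub>M\<^esub> x \<oplus>\<^bsub>M\<^esub> r \<odot>\<^bsub>M\<^esub> y"
    and smult_assoc:
      "\<lbrakk> r \<in> carrier R; s \<in> carrier R; x \<in> carrier M \<rbrakk> \<Longrightarrow>
        s \<odot>\<^bsub>M\<^esub> (r \<odot>\<^bsub>M\<^esub> x) = (r \<otimes>\<^bsub>R\<^esub> s) \<odot>\<^bsub>M\<^esub> x"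
    and smult_one: "x \<in> carrier M \<Longrightarrow> \<one>\<^bsub>R\<^esub> \<odot>\<^bsub>M\<^esub> x = x"

definition right_regular :: "('a, 'm) ring_scheme \<Rightarrow> ('a, 'a) module" where
  "right_regular R =
    \<lparr>carrier = carrier R, monoid.mult = monoid.mult R, one = \<one>\<^bsub>R\<^esub>, ring.zero = \<zero>\<^bsub>R\<^esub>, add = add R,
     smult = (\<lambda>r x. x \<otimes>\<^bsub>R\<^esub> r)\<rparr>"

definition left_regular :: "('a, 'm) ring_scheme \<Rightarrow> ('a, 'a) module" where
  "left_regular R =
    \<lparr>carrier = carrier R, monoid.mult = monoid.mult R, one = \<one>\<^bsub>R\<^esub>, ring.zero = \<zero>\<^bsub>R\<^esub>, add = add R,
     smult = (\<lambda>r x. r \<otimes>\<^bsub>R\<^esub> x)\<rparr>"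

lemma right_regular_module:
  assumes "ring R"
  shows "right_module R (right_regular R)"
proof -
  interpret ring R by fact
  have "abelian_group (right_regular R)"
    by (rule abelian_groupI)
       (auto simp: right_regular_def a_ac intro: bexI[of _ "\<ominus>\<^bsub>R\<^esub> _"] l_neg)
  then show ?thesis
    by (intro right_module.intro right_module_axioms.intro assms)
       (simp_all add: right_regular_def l_distr r_distr m_assoc)
qed

text \<open>
  The following notions mention the ring only through its carrier, so they apply verbatim to right
  and to left modules. Note that \<^locale>\<open>submodule\<close> does not presuppose commutativity of \<open>R\<close>.
\<close>

definition submodule_iso ::
    "('a, 'm) ring_scheme \<Rightarrow> ('a, 'b, 'k) module_scheme \<Rightarrow> 'b set \<Rightarrow> 'b set \<Rightarrow> bool" where
  "submodule_iso R M N P \<longleftrightarrow>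
    (\<exists>f. bij_betw f N P \<and>
      (\<forall>x\<in>N. \<forall>y\<in>N. f (x \<oplus>\<^bsub>M\<^esub> y) = f x \<oplus>\<^bsub>M\<^esub> f y) \<and>
      (\<forall>r\<in>carrier R. \<forall>x\<in>N. f (r \<odot>\<^bsub>M\<^esub> x) = r \<odot>\<^bsub>M\<^esub> f x))"

definition isoartinian_module ::
    "('a, 'm) ring_scheme \<Rightarrow> ('a, 'b, 'k) module_scheme \<Rightarrow> bool" where
  "isoartinian_module R M \<longleftrightarrow>
    (\<forall>N :: nat \<Rightarrow> 'b set.
      (\<forall>i. submodule (N i) R M) \<and> (\<forall>i. N (Suc i) \<subseteq> N i) \<longrightarrow>
      (\<exists>n. \<forall>i\<ge>n. submodule_iso R M (N i) (N n)))"

definition artinian_module ::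
    "('a, 'm) ring_scheme \<Rightarrow> ('a, 'b, 'k) module_scheme \<Rightarrow> bool" where
  "artinian_module R M \<longleftrightarrow>
    (\<forall>N :: nat \<Rightarrow> 'b set.
      (\<forall>i. submodule (N i) R M) \<and> (\<forall>i. N (Suc i) \<subseteq> N i) \<longrightarrow>
      (\<exists>n. \<forall>i\<ge>n. N i = N n))"

definition noetherian_module ::
    "('a, 'm) ring_scheme \<Rightarrow> ('a, 'b, 'k) module_scheme \<Rightarrow> bool" where
  "noetherian_module R M \<longleftrightarrow>
    (\<forall>N :: nat \<Rightarrow> 'b set.
      (\<forall>i. submodule (N i) R M) \<and> (\<forall>i. N i \<subseteq> N (Suc i)) \<longrightarrow>
      (\<exists>n. \<forall>i\<ge>n. N i = N n))"

section \<open>Classes of rings\<close>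

definition right_isoartinian :: "('a, 'm) ring_scheme \<Rightarrow> bool" where
  "right_isoartinian R \<longleftrightarrow> ring R \<and> isoartinian_module R (right_regular R)"

definition right_artinian :: "('a, 'm) ring_scheme \<Rightarrow> bool" where
  "right_artinian R \<longleftrightarrow> ring R \<and> artinian_module R (right_regular R)"

definition left_artinian :: "('a, 'm) ring_scheme \<Rightarrow> bool" where
  "left_artinian R \<longleftrightarrow> ring R \<and> artinian_module R (left_regular R)"

definition right_noetherian :: "('a, 'm) ring_scheme \<Rightarrow> bool" where
  "right_noetherian R \<longleftrightarrow> ring R \<and> noetherian_module R (right_regular R)"

text \<open>The zero ring is not excluded here; \<^const>\<open>ideal\<close> means two-sided ideal.\<close>

definition simple_ring :: "('a, 'm) ring_scheme \<Rightarrow> bool" where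
  "simple_ring R \<longleftrightarrow> ring R \<and> (\<forall>I. ideal I R \<longrightarrow> I = {\<zero>\<^bsub>R\<^esub>} \<or> I = carrier R)"

text \<open>As usual, \<open>artinian\<close> without a side means artinian on both sides.\<close>

definition simple_artinian :: "('a, 'm) ring_scheme \<Rightarrow> bool" where
  "simple_artinian R \<longleftrightarrow> simple_ring R \<and> left_artinian R \<and> right_artinian R"

definition division_ring :: "('a, 'm) ring_scheme \<Rightarrow> bool" where
  "division_ring D \<longleftrightarrow>
    ring D \<and> \<one>\<^bsub>D\<^esub> \<noteq> \<zero>\<^bsub>D\<^esub> \<and> Units D = carrier D - {\<zero>\<^bsub>D\<^esub>}"

definition right_ideal :: "'a set \<Rightarrow> ('a, 'm) ring_scheme \<Rightarrow> bool" where
  "right_ideal I R \<longleftrightarrow> submodule I R (right_regular R)"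

text \<open>
  The locale \<^locale>\<open>domain\<close> is restricted to commutative rings. The coset \<open>a <# carrier D\<close> is the
  principal right ideal \<open>a D\<close>.
\<close>

locale principal_right_ideal_domain = ring D for D (structure) +
  assumes one_not_zero: "\<one> \<noteq> \<zero>"
    and integral:
      "\<lbrakk> a \<in> carrier D; b \<in> carrier D; a \<otimes> b = \<zero> \<rbrakk> \<Longrightarrow> a = \<zero> \<or> b = \<zero>"
    and right_ideal_principal:
      "right_ideal I D \<Longrightarrow> \<exists>a\<in>carrier D. I = a <# carrier D"

text \<open>
  Only the type \<open>'a mat\<close> is used from the matrix library, whose algebraic operations are tied to
  type classes.
\<close>

definition matrix_ring :: "nat \<Rightarrow> ('a, 'm) ring_scheme \<Rightarrow> 'a mat ring" where
  "matrix_ring n D =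
    \<lparr>carrier = {A \<in> carrier_mat n n. \<forall>i<n. \<forall>j<n. A $$ (i, j) \<in> carrier D},
     monoid.mult = (\<lambda>A B. mat n n (\<lambda>(i, j). (\<Oplus>\<^bsub>D\<^esub>k\<in>{..<n}. A $$ (i, k) \<otimes>\<^bsub>D\<^esub> B $$ (k, j)))),
     one = mat n n (\<lambda>(i, j). if i = j then \<one>\<^bsub>D\<^esub> else \<zero>\<^bsub>D\<^esub>),
     ring.zero = mat n n (\<lambda>(i, j). \<zero>\<^bsub>D\<^esub>),
     add = (\<lambda>A B. mat n n (\<lambda>(i, j). A $$ (i, j) \<oplus>\<^bsub>D\<^esub> B $$ (i, j)))\<rparr>"

lemma matrix_ring_is_ring:
  assumes "ring D"
  shows "ring (matrix_ring n D)"
proof -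
  interpret D: ring D by fact
  let ?M = "matrix_ring n D"
  have mem: "A \<in> carrier ?M \<longleftrightarrow>
      A \<in> carrier_mat n n \<and> (\<forall>i<n. \<forall>j<n. A $$ (i, j) \<in> carrier D)" for A
    by (simp add: matrix_ring_def)
  have dims: "dim_row A = n" "dim_col A = n" if "A \<in> carrier ?M" for A
    using that by (auto simp: mem)
  have ent: "A $$ (i, j) \<in> carrier D" if "A \<in> carrier ?M" "i < n" "j < n" for A i j
    using that by (auto simp: mem)
  have assoc: "(A \<otimes>\<^bsub>?M\<^esub> B) \<otimes>\<^bsub>?M\<^esub> C = A \<otimes>\<^bsub>?M\<^esub> (B \<otimes>\<^bsub>?M\<^esub> C)"
    if A: "A \<in> carrier ?M" and B: "B \<in> carrier ?M" and C: "C \<in> carrier ?M" for A B C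
  proof (rule eq_matI)
    fix i j
    assume "i < dim_row (A \<otimes>\<^bsub>?M\<^esub> (B \<otimes>\<^bsub>?M\<^esub> C))" and "j < dim_col (A \<otimes>\<^bsub>?M\<^esub> (B \<otimes>\<^bsub>?M\<^esub> C))"
    then have i: "i < n" and j: "j < n" by (auto simp: matrix_ring_def)
    note ents = ent[OF A] ent[OF B] ent[OF C]
    have swap: "(\<Oplus>\<^bsub>D\<^esub>k\<in>{..<n}. \<Oplus>\<^bsub>D\<^esub>l\<in>S. g k l) = (\<Oplus>\<^bsub>D\<^esub>l\<in>S. \<Oplus>\<^bsub>D\<^esub>k\<in>{..<n}. g k l)"
      if "finite S" "S \<subseteq> {..<n}" "\<And>k l. k < n \<Longrightarrow> l < n \<Longrightarrow> g k l \<in> carrier D" for g S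
      using that
    proof (induction S rule: finite_induct)
      case (insert x F)
      have "(\<Oplus>\<^bsub>D\<^esub>k\<in>{..<n}. \<Oplus>\<^bsub>D\<^esub>l\<in>insert x F. g k l)
          = (\<Oplus>\<^bsub>D\<^esub>k\<in>{..<n}. g k x \<oplus>\<^bsub>D\<^esub> (\<Oplus>\<^bsub>D\<^esub>l\<in>F. g k l))"
        using insert by (intro D.finsum_cong' refl) (auto intro!: D.finsum_closed D.finsum_insert)
      also have "\<dots> = (\<Oplus>\<^bsub>D\<^esub>k\<in>{..<n}. g k x) \<oplus>\<^bsub>D\<^esub> (\<Oplus>\<^bsub>D\<^esub>k\<in>{..<n}. \<Oplus>\<^bsub>D\<^esub>l\<in>F. g k l)"
        using insert by (intro D.finsum_addf) (auto intro!: D.finsum_closed)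
      also have "\<dots> = (\<Oplus>\<^bsub>D\<^esub>l\<in>insert x F. \<Oplus>\<^bsub>D\<^esub>k\<in>{..<n}. g k l)"
        using insert by (subst D.finsum_insert) (auto intro!: D.finsum_closed)
      finally show ?case .
    qed (simp add: D.finsum_zero)
    have "((A \<otimes>\<^bsub>?M\<^esub> B) \<otimes>\<^bsub>?M\<^esub> C) $$ (i, j)
        = (\<Oplus>\<^bsub>D\<^esub>k\<in>{..<n}. (\<Oplus>\<^bsub>D\<^esub>l\<in>{..<n}. A $$ (i, l) \<otimes>\<^bsub>D\<^esub> B $$ (l, k)) \<otimes>\<^bsub>D\<^esub> C $$ (k, j))"
      using i j ents
      by (simp add: matrix_ring_def)
         (intro D.finsum_cong' refl, auto intro!: D.finsum_closed)
    also have "\<dots> = (\<Oplus>\<^bsub>D\<^esub>k\<in>{..<n}. \<Oplus>\<^bsub>D\<^esub>l\<in>{..<n}. A $$ (i, l) \<otimes>\<^bsub>D\<^esub> B $$ (l, k) \<otimes>\<^bsub>D\<^esub> C $$ (k, j))"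
      using i j ents
      by (intro D.finsum_cong' refl) (auto intro!: D.finsum_closed D.finsum_ldistr)
    also have "\<dots> = (\<Oplus>\<^bsub>D\<^esub>l\<in>{..<n}. \<Oplus>\<^bsub>D\<^esub>k\<in>{..<n}. A $$ (i, l) \<otimes>\<^bsub>D\<^esub> B $$ (l, k) \<otimes>\<^bsub>D\<^esub> C $$ (k, j))"
      using i j ents by (intro swap) auto
    also have "\<dots> = (\<Oplus>\<^bsub>D\<^esub>l\<in>{..<n}. A $$ (i, l) \<otimes>\<^bsub>D\<^esub> (\<Oplus>\<^bsub>D\<^esub>k\<in>{..<n}. B $$ (l, k) \<otimes>\<^bsub>D\<^esub> C $$ (k, j)))"
      using i j ents
      by (intro D.finsum_cong' refl)
         (auto intro!: D.finsum_closed D.finsum_cong' simp: D.finsum_rdistr D.m_assoc)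
    also have "\<dots> = (A \<otimes>\<^bsub>?M\<^esub> (B \<otimes>\<^bsub>?M\<^esub> C)) $$ (i, j)"
      using i j ents
      by (simp add: matrix_ring_def)
         (intro D.finsum_cong' refl, auto intro!: D.finsum_closed)
    finally show "((A \<otimes>\<^bsub>?M\<^esub> B) \<otimes>\<^bsub>?M\<^esub> C) $$ (i, j) = (A \<otimes>\<^bsub>?M\<^esub> (B \<otimes>\<^bsub>?M\<^esub> C)) $$ (i, j)" .
  qed (auto simp: matrix_ring_def)
  have closed: "A \<otimes>\<^bsub>?M\<^esub> B \<in> carrier ?M" if "A \<in> carrier ?M" "B \<in> carrier ?M" for A B
    using ent[OF that(1)] ent[OF that(2)]
    by (simp add: mem) (auto simp: matrix_ring_def intro!: D.finsum_closed)
  have one: "\<one>\<^bsub>?M\<^esub> \<in> carrier ?M"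
    by (simp add: mem) (simp add: matrix_ring_def)
  have l_one: "\<one>\<^bsub>?M\<^esub> \<otimes>\<^bsub>?M\<^esub> A = A" if A: "A \<in> carrier ?M" for A
  proof (rule eq_matI)
    fix i j assume "i < dim_row A" "j < dim_col A"
    then have i: "i < n" and j: "j < n" using dims[OF A] by auto
    have "(\<one>\<^bsub>?M\<^esub> \<otimes>\<^bsub>?M\<^esub> A) $$ (i, j) = (\<Oplus>\<^bsub>D\<^esub>k\<in>{..<n}. if i = k then A $$ (k, j) else \<zero>\<^bsub>D\<^esub>)"
      using i j ent[OF A]
      by (simp add: matrix_ring_def) (intro D.finsum_cong' refl, auto)
    also have "\<dots> = A $$ (i, j)"
      using i j ent[OF A] by (intro D.add.finprod_singleton) auto
    finally show "(\<one>\<^bsub>?M\<^esub> \<otimes>\<^bsub>?M\<^esub> A) $$ (i, j) = A $$ (i, j)" .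
  qed (use dims[OF A] in \<open>auto simp: matrix_ring_def\<close>)
  have r_one: "A \<otimes>\<^bsub>?M\<^esub> \<one>\<^bsub>?M\<^esub> = A" if A: "A \<in> carrier ?M" for A
  proof (rule eq_matI)
    fix i j assume "i < dim_row A" "j < dim_col A"
    then have i: "i < n" and j: "j < n" using dims[OF A] by auto
    have "(A \<otimes>\<^bsub>?M\<^esub> \<one>\<^bsub>?M\<^esub>) $$ (i, j) = (\<Oplus>\<^bsub>D\<^esub>k\<in>{..<n}. if j = k then A $$ (i, k) else \<zero>\<^bsub>D\<^esub>)"
      using i j ent[OF A]
      by (simp add: matrix_ring_def) (intro D.finsum_cong' refl, auto)
    also have "\<dots> = A $$ (i, j)"
      using i j ent[OF A] by (intro D.add.finprod_singleton) auto
    finally show "(A \<otimes>\<^bsub>?M\<^esub> \<one>\<^bsub>?M\<^esub>) $$ (i, j) = A $$ (i, j)" .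
  qed (use dims[OF A] in \<open>auto simp: matrix_ring_def\<close>)
  show ?thesis
  proof (rule ringI)
    show "abelian_group ?M"
    proof (rule abelian_groupI)
      fix A assume A: "A \<in> carrier ?M"
      have "mat n n (\<lambda>(i, j). \<ominus>\<^bsub>D\<^esub> A $$ (i, j)) \<in> carrier ?M"
        using ent[OF A] by (simp add: mem)
      moreover have "mat n n (\<lambda>(i, j). \<ominus>\<^bsub>D\<^esub> A $$ (i, j)) \<oplus>\<^bsub>?M\<^esub> A = \<zero>\<^bsub>?M\<^esub>"
        using ent[OF A] by (intro eq_matI) (auto simp: matrix_ring_def D.l_neg)
      ultimately show "\<exists>B\<in>carrier ?M. B \<oplus>\<^bsub>?M\<^esub> A = \<zero>\<^bsub>?M\<^esub>" by blast
    next
      fix A B assume "A \<in> carrier ?M" "B \<in> carrier ?M"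
      then show "A \<oplus>\<^bsub>?M\<^esub> B \<in> carrier ?M"
        using ent by (simp add: mem) (simp add: matrix_ring_def)
    next
      show "\<zero>\<^bsub>?M\<^esub> \<in> carrier ?M"
        by (simp add: mem) (simp add: matrix_ring_def)
    next
      fix A B C assume *: "A \<in> carrier ?M" "B \<in> carrier ?M" "C \<in> carrier ?M"
      then show "A \<oplus>\<^bsub>?M\<^esub> B \<oplus>\<^bsub>?M\<^esub> C = A \<oplus>\<^bsub>?M\<^esub> (B \<oplus>\<^bsub>?M\<^esub> C)"
        using ent[OF *(1)] ent[OF *(2)] ent[OF *(3)]
        by (intro eq_matI) (auto simp: matrix_ring_def D.a_assoc)
    next
      fix A B assume *: "A \<in> carrier ?M" "B \<in> carrier ?M"
      then show "A \<oplus>\<^bsub>?M\<^esub> B = B \<oplus>\<^bsub>?M\<^esub> A"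
        using ent[OF *(1)] ent[OF *(2)]
        by (intro eq_matI) (auto simp: matrix_ring_def D.a_comm)
    next
      fix A assume A: "A \<in> carrier ?M"
      then show "\<zero>\<^bsub>?M\<^esub> \<oplus>\<^bsub>?M\<^esub> A = A"
        using ent[OF A] dims[OF A] by (intro eq_matI) (auto simp: matrix_ring_def)
    qed
    show "monoid ?M"
      by (rule monoidI) (auto simp: closed one assoc l_one r_one)
  next
    fix A B C assume *: "A \<in> carrier ?M" "B \<in> carrier ?M" "C \<in> carrier ?M"
    note ents = ent[OF *(1)] ent[OF *(2)] ent[OF *(3)]
    show "(A \<oplus>\<^bsub>?M\<^esub> B) \<otimes>\<^bsub>?M\<^esub> C = A \<otimes>\<^bsub>?M\<^esub> C \<oplus>\<^bsub>?M\<^esub> B \<otimes>\<^bsub>?M\<^esub> C"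
      using ents
      by (intro eq_matI)
         (auto simp: matrix_ring_def D.l_distr simp flip: D.finsum_addf intro!: D.finsum_cong')
    show "C \<otimes>\<^bsub>?M\<^esub> (A \<oplus>\<^bsub>?M\<^esub> B) = C \<otimes>\<^bsub>?M\<^esub> A \<oplus>\<^bsub>?M\<^esub> C \<otimes>\<^bsub>?M\<^esub> B"
      using ents
      by (intro eq_matI)
         (auto simp: matrix_ring_def D.r_distr simp flip: D.finsum_addf intro!: D.finsum_cong')
  qed
qed

end

theory Submission
  imports Defs
begin

text \<open>
  Call a nonzero right ideal isosimple if it is isomorphic to all its nonzero submodules. The chain
  condition yields an isosimple right ideal \<open>U\<close> of \<open>R\<close>, and simplicity of \<open>R\<close> yields
  \<open>u\<^sub>1, \<dots>, u\<^sub>n \<in> U\<close> without common right annihilator, so that \<open>R\<close> embeds in \<open>U\<^sup>n\<close>. If \<open>n\<close> is minimal,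
  then \<open>U\<^sup>n\<close> embeds in \<open>R\<close> as well: the elements killed by all \<open>u\<^sub>j\<close> with \<open>j \<noteq> i\<close> form a nonzero
  right ideal that \<open>u\<^sub>i\<close> maps injectively to \<open>U\<close>. Composing the two embeddings gives a descending
  chain whose terms are alternately isomorphic to \<open>R\<close> and \<open>U\<^sup>n\<close>, hence \<open>R \<cong> U\<^sup>n\<close>. Then \<open>U \<cong> e R\<close> for
  an idempotent \<open>e\<close>, and \<open>R\<close> is the matrix ring over \<open>D = e R e\<close>.

  Conversely, let \<open>D\<close> be a principal right ideal domain and filter a right ideal \<open>I\<close> of \<open>M\<^sub>n(D)\<close> by
  the vanishing of the last rows of its elements. Each layer is zero or isomorphic to the projective
  module of row vectors, so the isomorphism class of \<open>I\<close> is determined by the set of indices of the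
  nonzero layers, which can only shrink along a descending chain. Over a division ring, nested right
  ideals with the same set of indices are equal.
\<close>

section \<open>Right ideals and their isomorphisms\<close>

context ring
begin

abbreviation iso_right :: "'a set \<Rightarrow> 'a set \<Rightarrow> bool"  (infix \<open>\<sim>\<^sub>R\<close> 50)
  where "N \<sim>\<^sub>R P \<equiv> submodule_iso R (right_regular R) N P"

text \<open>Homomorphisms of right modules from \<open>N\<close> into \<open>R\<close>. The image is
  left open, so that one predicate serves embeddings as well as isomorphisms onto right
  ideals.\<close>

definition right_linear :: "'a set \<Rightarrow> ('a \<Rightarrow> 'a) \<Rightarrow> bool" where
  "right_linear N f \<longleftrightarrow> f \<in> N \<rightarrow> carrier R \<and> (\<forall>x\<in>N. \<forall>y\<in>N. f (x \<oplus> y) = f x \<oplus> f y) \<and>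
     (\<forall>x\<in>N. \<forall>r\<in>carrier R. f (x \<otimes> r) = f x \<otimes> r)"

lemma right_linearD:
  assumes "right_linear N f"
  shows "x \<in> N \<Longrightarrow> f x \<in> carrier R"
    and "x \<in> N \<Longrightarrow> y \<in> N \<Longrightarrow> f (x \<oplus> y) = f x \<oplus> f y"
    and "x \<in> N \<Longrightarrow> r \<in> carrier R \<Longrightarrow> f (x \<otimes> r) = f x \<otimes> r"
  using assms by (auto simp: right_linear_def)

text \<open>A witness of \<open>submodule_iso\<close> is not said to map into the carrier; this
  comes from surjectivity onto a set \<open>P\<close> inside the carrier.\<close>

lemma iso_right_iff:
  assumes "P \<subseteq> carrier R"
  shows "N \<sim>\<^sub>R P \<longleftrightarrow> (\<exists>f. bij_betw f N P \<and> right_linear N f)"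
proof -
  have "bij_betw f N P \<Longrightarrow> f \<in> N \<rightarrow> carrier R" for f
    using assms by (auto simp: bij_betw_def)
  then show ?thesis
    unfolding submodule_iso_def right_linear_def by (simp add: right_regular_def) blast
qed

lemma iso_right_refl: "N \<sim>\<^sub>R N"
  unfolding submodule_iso_def by (intro exI[of _ id]) auto

lemma iso_right_trans: "N \<sim>\<^sub>R P \<Longrightarrow> P \<sim>\<^sub>R Q \<Longrightarrow> N \<sim>\<^sub>R Q"
  unfolding submodule_iso_def
proof (elim exE conjE)
  fix f g
  assume *: "bij_betw f N P" "bij_betw g P Q"
    "\<forall>x\<in>N. \<forall>y\<in>N. f (x \<oplus>\<^bsub>right_regular R\<^esub> y) = f x \<oplus>\<^bsub>right_regular R\<^esub> f y"
    "\<forall>r\<in>carrier R. \<forall>x\<in>N. f (r \<odot>\<^bsub>right_regular R\<^esub> x) = r \<odot>\<^bsub>right_regular R\<^esub> f x"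
    "\<forall>x\<in>P. \<forall>y\<in>P. g (x \<oplus>\<^bsub>right_regular R\<^esub> y) = g x \<oplus>\<^bsub>right_regular R\<^esub> g y"
    "\<forall>r\<in>carrier R. \<forall>x\<in>P. g (r \<odot>\<^bsub>right_regular R\<^esub> x) = r \<odot>\<^bsub>right_regular R\<^esub> g x"
  have "f x \<in> P" if "x \<in> N" for x using *(1) that by (auto simp: bij_betw_def)
  then show "\<exists>f. bij_betw f N Q \<and>
        (\<forall>x\<in>N. \<forall>y\<in>N. f (x \<oplus>\<^bsub>right_regular R\<^esub> y) = f x \<oplus>\<^bsub>right_regular R\<^esub> f y) \<and>
        (\<forall>r\<in>carrier R. \<forall>x\<in>N. f (r \<odot>\<^bsub>right_regular R\<^esub> x) = r \<odot>\<^bsub>right_regular R\<^esub> f x)"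
    using * by (intro exI[of _ "g \<circ> f"]) (simp add: bij_betw_trans)
qed

text \<open>Additive inverses come from scalar multiplication, as
  \<open>\<ominus> x = x \<otimes> (\<ominus> \<one>)\<close>.\<close>

lemma right_ideal_iff:
  "right_ideal I R \<longleftrightarrow> I \<subseteq> carrier R \<and> \<zero> \<in> I \<and> (\<forall>x\<in>I. \<forall>y\<in>I. x \<oplus> y \<in> I) \<and>
     (\<forall>x\<in>I. \<forall>r\<in>carrier R. x \<otimes> r \<in> I)" (is "_ \<longleftrightarrow> ?r")
proof
  let ?M = "right_regular R"
  assume "right_ideal I R"
  then interpret submodule I R ?M by (simp add: right_ideal_def)
  show ?r
    using subset one_closed m_closed smult_closed by (auto simp: right_regular_def)
next
  let ?M = "right_regular R"
  interpret M: right_module R ?M by (rule right_regular_module) (rule ring_axioms)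
  assume r: ?r
  have inv: "inv\<^bsub>add_monoid ?M\<^esub> x \<in> I" if x: "x \<in> I" for x
  proof -
    have xc: "x \<in> carrier R" using r x by auto
    have "inv\<^bsub>add_monoid ?M\<^esub> x = \<ominus> x"
      using M.M.add.inv_equality[of "\<ominus> x" x] xc by (simp add: right_regular_def l_neg a_inv_def)
    also have "\<dots> = x \<otimes> (\<ominus> \<one>)" using xc by (simp add: r_minus)
    also have "\<dots> \<in> I" using r x by simp
    finally show ?thesis .
  qed
  have "subgroup I (add_monoid ?M)"
    using r inv by (intro subgroup.intro) (auto simp: right_regular_def)
  then show "right_ideal I R"
    unfolding right_ideal_def
    using r by (intro submodule.intro submodule_axioms.intro) (auto simp: right_regular_def)
qed

lemma right_idealD:
  assumes "right_ideal I R"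
  shows "x \<in> I \<Longrightarrow> x \<in> carrier R" "\<zero> \<in> I" "x \<in> I \<Longrightarrow> y \<in> I \<Longrightarrow> x \<oplus> y \<in> I"
    "x \<in> I \<Longrightarrow> r \<in> carrier R \<Longrightarrow> x \<otimes> r \<in> I" "x \<in> I \<Longrightarrow> \<ominus> x \<in> I"
    "x \<in> I \<Longrightarrow> y \<in> I \<Longrightarrow> x \<ominus> y \<in> I"
proof -
  show *: "x \<in> I \<Longrightarrow> x \<in> carrier R" "\<zero> \<in> I" "x \<in> I \<Longrightarrow> y \<in> I \<Longrightarrow> x \<oplus> y \<in> I"
    "x \<in> I \<Longrightarrow> r \<in> carrier R \<Longrightarrow> x \<otimes> r \<in> I" for x y r
    using assms by (auto simp: right_ideal_iff)
  show neg: "x \<in> I \<Longrightarrow> \<ominus> x \<in> I" for x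
    using *(4)[of x "\<ominus> \<one>"] *(1)[of x] by (simp add: r_minus)
  show "x \<in> I \<Longrightarrow> y \<in> I \<Longrightarrow> x \<ominus> y \<in> I"
    using *(3) neg by (simp add: minus_eq)
qed

lemma right_idealI:
  assumes "\<And>x. x \<in> I \<Longrightarrow> x \<in> carrier R" "\<zero> \<in> I" "\<And>x y. x \<in> I \<Longrightarrow> y \<in> I \<Longrightarrow> x \<oplus> y \<in> I"
    "\<And>x r. x \<in> I \<Longrightarrow> r \<in> carrier R \<Longrightarrow> x \<otimes> r \<in> I"
  shows "right_ideal I R"
  using assms by (auto simp: right_ideal_iff)

lemma right_linear_zero:
  assumes "right_ideal N R" "right_linear N f"
  shows "f \<zero> = \<zero>"
proof -
  have "f (\<zero> \<otimes> \<zero>) = f \<zero> \<otimes> \<zero>"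
    using right_linearD(3)[OF assms(2)] right_idealD(2)[OF assms(1)] by blast
  then show ?thesis
    using right_linearD(1)[OF assms(2)] right_idealD(2)[OF assms(1)] by simp
qed

lemma right_linear_minus:
  assumes "right_ideal N R" "right_linear N f" "x \<in> N" "y \<in> N"
  shows "f (x \<ominus> y) = f x \<ominus> f y"
proof -
  note N = right_idealD[OF assms(1)] and f = right_linearD[OF assms(2)]
  have "f (\<ominus> y) = \<ominus> f y"
    using f(3)[of y "\<ominus> \<one>"] N(1)[OF assms(4)] f(1)[OF assms(4)] assms(4) by (simp add: r_minus)
  then show ?thesis
    using f(2)[of x "\<ominus> y"] N(5) assms(3,4) by (simp add: minus_eq)
qed

lemma minus_eq_zero_iff:
  assumes "x \<in> carrier R" "y \<in> carrier R"
  shows "x \<ominus> y = \<zero> \<longleftrightarrow> x = y"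
  using assms by simp

lemma right_linear_injI:
  assumes N: "right_ideal N R" and f: "right_linear N f"
    and "\<And>x. x \<in> N \<Longrightarrow> f x = \<zero> \<Longrightarrow> x = \<zero>"
  shows "inj_on f N"
proof (rule inj_onI)
  fix x y assume *: "x \<in> N" "y \<in> N" "f x = f y"
  note c = right_linearD(1)[OF f]
  have "f (x \<ominus> y) = \<zero>"
    using right_linear_minus[OF N f *(1,2)] *(3) c *(1,2) by simp
  then have "x \<ominus> y = \<zero>" using assms(3) right_idealD(6)[OF N] * by blast
  then show "x = y" using right_idealD(1)[OF N] * by simp
qed

lemma right_linear_image:
  assumes N: "right_ideal N R" and f: "right_linear N f"
  shows "right_ideal (f ` N) R"
proof (rule right_idealI)
  note c = right_linearD[OF f] and Nc = right_idealD[OF N]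
  show "\<zero> \<in> f ` N" using right_linear_zero[OF N f] Nc(2) by force
  fix x assume x: "x \<in> f ` N"
  then show "x \<in> carrier R" using c(1) by auto
  from x obtain x' where x': "x' \<in> N" "x = f x'" by auto
  {
    fix y assume "y \<in> f ` N"
    then obtain y' where "y' \<in> N" "y = f y'" by auto
    then show "x \<oplus> y \<in> f ` N" using c(2) x' Nc(3) by force
  }
  fix r assume "r \<in> carrier R"
  then show "x \<otimes> r \<in> f ` N" using c(3) x' Nc(4) by force
qed

lemma iso_right_image:
  assumes N: "right_ideal N R" and f: "right_linear N f"
    and "\<And>x. x \<in> N \<Longrightarrow> f x = \<zero> \<Longrightarrow> x = \<zero>"
  shows "N \<sim>\<^sub>R f ` N"
proof -
  have "bij_betw f N (f ` N)" using right_linear_injI[OF assms] by (simp add: bij_betw_def)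
  then show ?thesis
    using f right_linearD(1)[OF f] by (subst iso_right_iff) auto
qed

lemma iso_right_sym:
  assumes N: "right_ideal N R" and P: "right_ideal P R" and "N \<sim>\<^sub>R P"
  shows "P \<sim>\<^sub>R N"
proof -
  have sub: "N \<subseteq> carrier R" "P \<subseteq> carrier R" using N P by (auto simp: right_ideal_iff)
  obtain f where f: "bij_betw f N P" "right_linear N f"
    using assms(3) iso_right_iff sub by blast
  let ?g = "inv_into N f"
  have g: "?g x \<in> N" "f (?g x) = x" if "x \<in> P" for x
    using f(1) that bij_betw_inv_into_right bij_betw_apply bij_betw_inv_into by metis+
  have gf: "?g (f x) = x" if "x \<in> N" for x
    using f(1) that bij_betw_inv_into_left by metis
  note F = right_linearD[OF f(2)]
  have "right_linear P ?g"
    unfolding right_linear_def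
  proof (intro conjI ballI)
    show "?g \<in> P \<rightarrow> carrier R" using g sub by auto
    fix x assume x: "x \<in> P"
    {
      fix y assume y: "y \<in> P"
      have "f (?g x \<oplus> ?g y) = x \<oplus> y" using F(2) g x y by simp
      then show "?g (x \<oplus> y) = ?g x \<oplus> ?g y"
        using gf[of "?g x \<oplus> ?g y"] right_idealD(3)[OF N] g x y by simp
    }
    fix r assume r: "r \<in> carrier R"
    have "f (?g x \<otimes> r) = x \<otimes> r" using F(3) g x r by simp
    then show "?g (x \<otimes> r) = ?g x \<otimes> r"
      using gf[of "?g x \<otimes> r"] right_idealD(4)[OF N] g x r by simp
  qed
  then show ?thesis
    using bij_betw_inv_into[OF f(1)] sub by (subst iso_right_iff) auto
qed

lemma right_linear_mult:
  assumes "c \<in> carrier R" "N \<subseteq> carrier R"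
  shows "right_linear N (\<lambda>x. c \<otimes> x)"
  using assms by (auto simp: right_linear_def r_distr m_assoc subset_iff)

lemma right_ideal_carrier: "right_ideal (carrier R) R"
  by (rule right_idealI) auto

lemma right_ideal_principal:
  assumes "c \<in> carrier R"
  shows "right_ideal (c <# carrier R) R"
proof -
  have "c <# carrier R = (\<lambda>x. c \<otimes> x) ` carrier R" by (auto simp: l_coset_def)
  then show ?thesis
    using right_linear_image[OF right_ideal_carrier right_linear_mult[OF assms]] by simp
qed

text \<open>The assumptions \<open>xe\<close> and \<open>ind\<close> say that \<open>x R\<close>
  meets \<open>A\<close> only in zero and that \<open>x\<close> has the same right annihilator as
  \<open>e\<close>, and likewise for \<open>x'\<close> and \<open>A'\<close>. Both sums are
  therefore direct, with second summand isomorphic to \<open>e R\<close>, and an isomorphism of the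
  first summands extends by \<open>x \<otimes> r \<mapsto> x' \<otimes> r\<close>. This is the
  inductive step for filtered right ideals.\<close>

lemma iso_right_direct_sum:
  assumes A: "right_ideal A R" and A': "right_ideal A' R" and iso: "A \<sim>\<^sub>R A'"
    and x: "x \<in> carrier R" "x' \<in> carrier R" and e: "e \<in> carrier R"
    and xe: "x \<otimes> e = x" "x' \<otimes> e = x'"
    and ind: "\<And>r. r \<in> carrier R \<Longrightarrow> x \<otimes> r \<in> A \<Longrightarrow> e \<otimes> r = \<zero>"
      "\<And>r. r \<in> carrier R \<Longrightarrow> x' \<otimes> r \<in> A' \<Longrightarrow> e \<otimes> r = \<zero>"
  shows "{a \<oplus> x \<otimes> r |a r. a \<in> A \<and> r \<in> carrier R} \<sim>\<^sub>R {a \<oplus> x' \<otimes> r |a r. a \<in> A' \<and> r \<in> carrier R}"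
    (is "?N \<sim>\<^sub>R ?P")
proof -
  have sub: "A \<subseteq> carrier R" "A' \<subseteq> carrier R" using A A' by (auto simp: right_ideal_iff)
  obtain f where f: "bij_betw f A A'" "right_linear A f"
    using iso iso_right_iff[OF sub(2)] by auto
  have fA: "f a \<in> A'" if "a \<in> A" for a using f(1) that by (auto simp: bij_betw_def)
  \<comment> \<open>An element of the sum determines its first component \<open>a\<close>, but
    \<open>r\<close> only up to the value of \<open>e \<otimes> r\<close>. Since this ambiguity is
    the same on both sides, the extended map is well defined and injective.\<close>
  have eq: "a \<oplus> z \<otimes> r = b \<oplus> z \<otimes> s \<longleftrightarrow> a = b \<and> e \<otimes> r = e \<otimes> s"
    if B: "right_ideal B R" and z: "z \<in> carrier R" "z \<otimes> e = z"
      "\<And>r. r \<in> carrier R \<Longrightarrow> z \<otimes> r \<in> B \<Longrightarrow> e \<otimes> r = \<zero>"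
      and ab: "a \<in> B" "b \<in> B" and rs: "r \<in> carrier R" "s \<in> carrier R" for B z a b r s
  proof
    note Bc = right_idealD[OF B]
    have c: "a \<in> carrier R" "b \<in> carrier R" using Bc ab by auto
    assume h: "a \<oplus> z \<otimes> r = b \<oplus> z \<otimes> s"
    have "z \<otimes> (r \<ominus> s) = (a \<oplus> z \<otimes> r) \<ominus> (a \<oplus> z \<otimes> s)"
      using c z rs by algebra
    also have "\<dots> = b \<ominus> a" unfolding h using c z rs by algebra
    finally have eqz: "z \<otimes> (r \<ominus> s) = b \<ominus> a" .
    then have "e \<otimes> (r \<ominus> s) = \<zero>" using z(3)[of "r \<ominus> s"] Bc ab rs by simp
    then have er: "e \<otimes> r = e \<otimes> s"
      using e rs minus_eq_zero_iff[of "e \<otimes> r" "e \<otimes> s"] by (simp add: minus_eq r_distr r_minus)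
    have "z \<otimes> r = z \<otimes> (e \<otimes> r)" "z \<otimes> s = z \<otimes> (e \<otimes> s)"
      using z e rs by (simp_all flip: m_assoc)
    then have "z \<otimes> r = z \<otimes> s" using er by simp
    then show "a = b \<and> e \<otimes> r = e \<otimes> s" using h er c z rs by simp
  next
    assume h: "a = b \<and> e \<otimes> r = e \<otimes> s"
    have "z \<otimes> r = z \<otimes> (e \<otimes> r)" "z \<otimes> s = z \<otimes> (e \<otimes> s)"
      using z e rs by (simp_all flip: m_assoc)
    then show "a \<oplus> z \<otimes> r = b \<oplus> z \<otimes> s" using h by simp
  qed
  have inj: "a = b \<longleftrightarrow> f a = f b" if "a \<in> A" "b \<in> A" for a b
    using f(1) that by (auto simp: bij_betw_def inj_on_def)
  let ?\<phi> = "\<lambda>(a, r). a \<oplus> x \<otimes> r" and ?\<psi> = "\<lambda>(a, r). f a \<oplus> x' \<otimes> r" and ?T = "A \<times> carrier R"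
  have same: "?\<phi> s = ?\<phi> t \<longleftrightarrow> ?\<psi> s = ?\<psi> t" if "s \<in> ?T" "t \<in> ?T" for s t
    using that eq[OF A x(1) xe(1) ind(1)] eq[OF A' x(2) xe(2) ind(2)] inj fA by force
  have N: "?N = ?\<phi> ` ?T" by auto
  have P: "?P = ?\<psi> ` ?T"
  proof -
    have "A' = f ` A" using f(1) by (auto simp: bij_betw_def)
    then show ?thesis by auto
  qed
  \<comment> \<open>\<open>inv_into\<close> picks some representation of \<open>z\<close> as a sum;
    by \<open>same\<close> the value does not depend on this choice.\<close>
  let ?h = "\<lambda>z. ?\<psi> (inv_into ?T ?\<phi> z)"
  have h: "?h (?\<phi> t) = ?\<psi> t" if "t \<in> ?T" for t
    using same[OF inv_into_into[of "?\<phi> t" ?\<phi> ?T] that] f_inv_into_f[of "?\<phi> t" ?\<phi> ?T] that by blast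
  have h': "?h (a \<oplus> x \<otimes> r) = f a \<oplus> x' \<otimes> r" if "a \<in> A" "r \<in> carrier R" for a r
    using h[of "(a, r)"] that by simp
  note Ac = right_idealD[OF A] and F = right_linearD[OF f(2)]
  have "bij_betw ?h ?N ?P"
    unfolding N P
  proof (rule bij_betw_imageI)
    show "inj_on ?h (?\<phi> ` ?T)"
    proof (rule inj_onI)
      fix u v assume "u \<in> ?\<phi> ` ?T" "v \<in> ?\<phi> ` ?T" "?h u = ?h v"
      then obtain s t where "s \<in> ?T" "t \<in> ?T" "u = ?\<phi> s" "v = ?\<phi> t" "?h (?\<phi> s) = ?h (?\<phi> t)"
        by blast
      then show "u = v" using h[of s] h[of t] same[of s t] by metis
    qed
    show "?h ` ?\<phi> ` ?T = ?\<psi> ` ?T"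
      unfolding image_image by (rule image_cong[OF refl h])
  qed
  moreover have "right_linear ?N ?h"
    unfolding right_linear_def
  proof (intro conjI ballI)
    show "?h \<in> ?N \<rightarrow> carrier R"
      using h' F(1) x by (auto simp del: split_paired_All)
    fix u assume "u \<in> ?N"
    then obtain a r where u: "u = a \<oplus> x \<otimes> r" "a \<in> A" "r \<in> carrier R" by auto
    have c: "a \<in> carrier R" "f a \<in> carrier R" using u Ac F by auto
    {
      fix v assume "v \<in> ?N"
      then obtain b s where v: "v = b \<oplus> x \<otimes> s" "b \<in> A" "s \<in> carrier R" by auto
      have c': "b \<in> carrier R" "f b \<in> carrier R" using v Ac F by auto
      have "u \<oplus> v = (a \<oplus> b) \<oplus> x \<otimes> (r \<oplus> s)" using u v c c' x by (simp add: r_distr a_ac)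
      then have "?h (u \<oplus> v) = f (a \<oplus> b) \<oplus> x' \<otimes> (r \<oplus> s)"
        using h'[of "a \<oplus> b" "r \<oplus> s"] u v Ac by simp
      also have "\<dots> = (f a \<oplus> x' \<otimes> r) \<oplus> (f b \<oplus> x' \<otimes> s)"
        using u v c c' x F by (simp add: r_distr a_ac)
      finally show "?h (u \<oplus> v) = ?h u \<oplus> ?h v" using h' u v by simp
    }
    fix s assume s: "s \<in> carrier R"
    have "u \<otimes> s = a \<otimes> s \<oplus> x \<otimes> (r \<otimes> s)" using u c x s by (simp add: l_distr m_assoc)
    then have "?h (u \<otimes> s) = f (a \<otimes> s) \<oplus> x' \<otimes> (r \<otimes> s)"
      using h'[of "a \<otimes> s" "r \<otimes> s"] u s Ac by simp
    also have "\<dots> = (f a \<oplus> x' \<otimes> r) \<otimes> s"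
      using u c x s F by (simp add: l_distr m_assoc)
    finally show "?h (u \<otimes> s) = ?h u \<otimes> s" using h' u by simp
  qed
  ultimately show ?thesis
    using sub x by (subst iso_right_iff) (auto simp: subset_iff)
qed

end

lemma (in ring) right_ideal_finsum:
  assumes I: "right_ideal I R" and "finite A" "\<And>i. i \<in> A \<Longrightarrow> f i \<in> I"
  shows "finsum R f A \<in> I"
  using assms(2,3)
proof (induction A rule: finite_induct)
  case (insert x F)
  have "finsum R f (insert x F) = f x \<oplus> finsum R f F"
    using insert right_idealD(1)[OF I] by (intro finsum_insert) auto
  then show ?case using insert right_idealD(3)[OF I] by simp
qed (simp add: right_idealD[OF I])

text \<open>A term of least cardinality contains every later term, and none of them can be
  smaller.\<close>

lemma decreasing_chain_stabilises:
  fixes S :: "nat \<Rightarrow> 'x set"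
  assumes "\<And>i. S (Suc i) \<subseteq> S i" "finite (S 0)"
  shows "\<exists>m. \<forall>i\<ge>m. S i = S m"
proof -
  have dec: "S j \<subseteq> S i" if "i \<le> j" for i j
    using that assms(1) by (rule lift_Suc_antimono_le[rotated])
  have fin: "finite (S i)" for i
    using dec[of 0 i] assms(2) finite_subset by auto
  obtain m where m: "\<And>i. card (S m) \<le> card (S i)"
    using ex_has_least_nat[of "\<lambda>_. True" 0 "\<lambda>i. card (S i)"] by auto
  have "S i = S m" if "i \<ge> m" for i
    using card_seteq[OF fin dec[OF that] m] .
  then show ?thesis by blast
qed

section \<open>Rings with a full system of matrix units\<close>

text \<open>
  Column vectors \<open>a\<^sub>i\<close> and row vectors \<open>b\<^sub>j\<close> over the corner \<open>e R e\<close>: in a matrix ring,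
  \<open>e = E\<^sub>0\<^sub>0\<close>, \<open>a\<^sub>i = E\<^sub>i\<^sub>0\<close> and \<open>b\<^sub>j = E\<^sub>0\<^sub>j\<close>.
\<close>

locale matrix_frame = ring R for R (structure) +
  fixes n :: nat and a b :: "nat \<Rightarrow> 'a" and e :: 'a
  assumes a_closed [simp]: "i < n \<Longrightarrow> a i \<in> carrier R"
    and b_closed [simp]: "i < n \<Longrightarrow> b i \<in> carrier R"
    and e_closed [simp]: "e \<in> carrier R"
    and e_idem: "e \<otimes> e = e"
    and a_e: "i < n \<Longrightarrow> a i \<otimes> e = a i"
    and e_b: "i < n \<Longrightarrow> e \<otimes> b i = b i"
    and b_a: "i < n \<Longrightarrow> j < n \<Longrightarrow> b i \<otimes> a j = (if i = j then e else \<zero>)"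
    and a_b: "(\<Oplus>i\<in>{..<n}. a i \<otimes> b i) = \<one>"
begin

text \<open>Since the sum of the \<open>a i \<otimes> b i\<close> is one, an element is recovered
  from its rows \<open>b i \<otimes> x\<close>, and dually from its columns
  \<open>x \<otimes> a i\<close>.\<close>

lemma frame_left:
  assumes "x \<in> carrier R"
  shows "(\<Oplus>i\<in>{..<n}. a i \<otimes> (b i \<otimes> x)) = x"
proof -
  have "(\<Oplus>i\<in>{..<n}. a i \<otimes> (b i \<otimes> x)) = (\<Oplus>i\<in>{..<n}. (a i \<otimes> b i) \<otimes> x)"
    using assms by (intro finsum_cong') (auto simp: m_assoc)
  also have "\<dots> = x"
    using assms by (subst finsum_ldistr[symmetric]) (auto simp: a_b)
  finally show ?thesis .
qed

lemma frame_right: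
  assumes "x \<in> carrier R"
  shows "(\<Oplus>i\<in>{..<n}. (x \<otimes> a i) \<otimes> b i) = x"
proof -
  have "(\<Oplus>i\<in>{..<n}. (x \<otimes> a i) \<otimes> b i) = (\<Oplus>i\<in>{..<n}. x \<otimes> (a i \<otimes> b i))"
    using assms by (intro finsum_cong') (auto simp: m_assoc)
  also have "\<dots> = x"
    using assms by (subst finsum_rdistr[symmetric]) (auto simp: a_b)
  finally show ?thesis .
qed

lemma eq_zeroI_b:
  assumes "x \<in> carrier R" "\<And>i. i < n \<Longrightarrow> b i \<otimes> x = \<zero>"
  shows "x = \<zero>"
proof -
  have "(\<Oplus>i\<in>{..<n}. a i \<otimes> (b i \<otimes> x)) = (\<Oplus>i\<in>{..<n}. \<zero>)"
    using assms by (intro finsum_cong') auto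
  then show ?thesis using frame_left[OF assms(1)] finsum_zero by simp
qed

lemma eq_zeroI_a:
  assumes "x \<in> carrier R" "\<And>i. i < n \<Longrightarrow> x \<otimes> a i = \<zero>"
  shows "x = \<zero>"
proof -
  have "(\<Oplus>i\<in>{..<n}. (x \<otimes> a i) \<otimes> b i) = (\<Oplus>i\<in>{..<n}. \<zero>)"
    using assms by (intro finsum_cong') auto
  then show ?thesis using frame_right[OF assms(1)] finsum_zero by simp
qed

text \<open>In a matrix ring, \<open>b j \<otimes> x\<close> is row \<open>j\<close> of
  \<open>x\<close> moved to the top. So \<open>filt k\<close> consists of the matrices supported in
  the first \<open>k\<close> rows.\<close>

definition filt :: "nat \<Rightarrow> 'a set" where
  "filt k = {x \<in> carrier R. \<forall>j. k \<le> j \<longrightarrow> j < n \<longrightarrow> b j \<otimes> x = \<zero>}"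

text \<open>Left multiplication by \<open>b i\<close> has kernel \<open>I \<inter> filt i\<close> on
  \<open>I \<inter> filt (Suc i)\<close>, so it embeds the quotient of the two in
  \<open>e R\<close>. The set collects the indices at which this layer is nonzero.\<close>

definition lead :: "'a set \<Rightarrow> nat set" where
  "lead I = {i. i < n \<and> (\<exists>x\<in>I \<inter> filt (Suc i). b i \<otimes> x \<noteq> \<zero>)}"

lemma filt_0: "filt 0 = {\<zero>}"
  using eq_zeroI_b by (auto simp: filt_def)

lemma filt_n: "filt n = carrier R"
  by (auto simp: filt_def)

lemma right_ideal_filt_Int:
  assumes "right_ideal I R"
  shows "right_ideal (I \<inter> filt k) R"
  using right_idealD[OF assms]
  by (intro right_idealI) (auto simp: filt_def r_distr simp flip: m_assoc)

lemma lead_mono: "I \<subseteq> J \<Longrightarrow> lead I \<subseteq> lead J"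
  by (auto simp: lead_def)

lemma lead_subset: "lead I \<subseteq> {..<n}"
  by (auto simp: lead_def)

lemma filt_Suc_Int:
  assumes "k < n" "k \<notin> lead I"
  shows "I \<inter> filt (Suc k) = I \<inter> filt k"
proof
  show "I \<inter> filt k \<subseteq> I \<inter> filt (Suc k)" by (auto simp: filt_def)
  show "I \<inter> filt (Suc k) \<subseteq> I \<inter> filt k"
  proof
    fix x assume x: "x \<in> I \<inter> filt (Suc k)"
    then have "b k \<otimes> x = \<zero>" using assms by (auto simp: lead_def)
    then have "b j \<otimes> x = \<zero>" if "k \<le> j" "j < n" for j
      using that x by (cases "j = k") (auto simp: filt_def)
    then show "x \<in> I \<inter> filt k" using x by (auto simp: filt_def)
  qed
qed

end

text \<open>The hypothesis expresses that \<open>e R\<close> is isomorphic to each of its nonzero submodules.\<close>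

locale isosimple_frame = matrix_frame +
  assumes isosimple: "\<lbrakk>right_ideal L R; L \<subseteq> e <# carrier R; L \<noteq> {\<zero>}\<rbrakk> \<Longrightarrow>
    \<exists>d\<in>L. d \<otimes> e = d \<and> L = d <# carrier R \<and> (\<forall>y\<in>carrier R. d \<otimes> y = \<zero> \<longrightarrow> e \<otimes> y = \<zero>)"
begin

text \<open>The layer at \<open>k\<close> is a nonzero submodule of \<open>e R\<close>, so it has a
  generator with the right annihilator of \<open>e\<close>. Lifting this generator to
  \<open>I\<close> splits the layer off as a direct summand, in the form required by
  \<open>iso_right_direct_sum\<close>.\<close>

lemma lead_generator:
  assumes I: "right_ideal I R" and k: "k \<in> lead I"
  obtains x where "x \<in> carrier R" "x \<otimes> e = x"
    "\<And>r. r \<in> carrier R \<Longrightarrow> x \<otimes> r \<in> I \<inter> filt k \<Longrightarrow> e \<otimes> r = \<zero>"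
    "I \<inter> filt (Suc k) = {c \<oplus> x \<otimes> r |c r. c \<in> I \<inter> filt k \<and> r \<in> carrier R}"
proof -
  have kn: "k < n" using k by (auto simp: lead_def)
  let ?I = "I \<inter> filt (Suc k)" and ?b = "\<lambda>x. b k \<otimes> x"
  note Ic = right_idealD[OF I] and Ik = right_idealD[OF right_ideal_filt_Int[OF I]]
  have ri: "right_ideal (?b ` ?I) R"
    using kn Ic by (intro right_linear_image right_ideal_filt_Int I right_linear_mult) auto
  have sub: "?b ` ?I \<subseteq> e <# carrier R"
  proof
    fix y assume "y \<in> ?b ` ?I"
    then obtain x where x: "x \<in> carrier R" "y = b k \<otimes> x" using Ic by auto
    then have "y = e \<otimes> (b k \<otimes> x)" using kn e_b[of k] by (simp flip: m_assoc)
    then show "y \<in> e <# carrier R" using x kn by (auto simp: l_coset_def)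
  qed
  have "?b ` ?I \<noteq> {\<zero>}" using k by (auto simp: lead_def)
  from isosimple[OF ri sub this]
  obtain x0 where x0: "x0 \<in> ?I" "?b x0 \<otimes> e = ?b x0" "?b ` ?I = ?b x0 <# carrier R"
    "\<forall>y\<in>carrier R. ?b x0 \<otimes> y = \<zero> \<longrightarrow> e \<otimes> y = \<zero>" by blast
  \<comment> \<open>The lift \<open>x0\<close> need not be fixed by right multiplication with
    \<open>e\<close>. Multiplying it by \<open>e\<close> repairs this without changing row
    \<open>k\<close>.\<close>
  define x where "x = x0 \<otimes> e"
  have x0c: "x0 \<in> carrier R" using x0 Ic by auto
  have xI: "x \<in> ?I" unfolding x_def using x0(1) Ik(4) e_closed by blast
  then have xc: "x \<in> carrier R" using Ic by auto
  have bx: "?b x = ?b x0" using x0 x0c kn by (simp add: x_def flip: m_assoc)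
  show thesis
  proof
    show "x \<in> carrier R" by fact
    show "x \<otimes> e = x" using x0c by (simp add: x_def m_assoc e_idem)
    show "e \<otimes> r = \<zero>" if r: "r \<in> carrier R" "x \<otimes> r \<in> I \<inter> filt k" for r
    proof -
      have "b k \<otimes> (x \<otimes> r) = \<zero>" using r kn by (auto simp: filt_def)
      then show ?thesis using x0(4) r(1) bx xc kn by (simp flip: m_assoc)
    qed
    show "?I = {c \<oplus> x \<otimes> r |c r. c \<in> I \<inter> filt k \<and> r \<in> carrier R}" (is "_ = ?S")
    proof
      show "?S \<subseteq> ?I"
      proof
        fix y assume "y \<in> ?S"
        then obtain c r where "y = c \<oplus> x \<otimes> r" "c \<in> I \<inter> filt k" "r \<in> carrier R" by auto
        moreover from this have "c \<in> ?I" by (auto simp: filt_def)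
        ultimately show "y \<in> ?I" using xI Ik(3,4) by blast
      qed
      show "?I \<subseteq> ?S"
      proof
        fix z assume z: "z \<in> ?I"
        then have zc: "z \<in> carrier R" using Ic by auto
        have "?b z \<in> ?b x0 <# carrier R" using z x0(3) by blast
        then obtain r where r: "r \<in> carrier R" "?b z = ?b x0 \<otimes> r"
          by (auto simp: l_coset_def)
        have bz: "?b z = ?b (x \<otimes> r)" using r bx xc kn by (simp flip: m_assoc)
        \<comment> \<open>Subtracting the multiple of \<open>x\<close> with the same row
          \<open>k\<close> moves \<open>z\<close> one step down in the filtration.\<close>
        have zx: "z \<ominus> x \<otimes> r \<in> ?I" using z xI r Ik(4,6) by blast
        have "b j \<otimes> (z \<ominus> x \<otimes> r) = \<zero>" if j: "k \<le> j" "j < n" for j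
        proof (cases "j = k")
          case True
          then show ?thesis using bz zc xc r kn by (simp add: minus_eq r_distr r_minus r_neg)
        next
          case False
          then show ?thesis using zx j by (auto simp: filt_def)
        qed
        then have "z \<ominus> x \<otimes> r \<in> I \<inter> filt k" using zx by (auto simp: filt_def)
        moreover have "z = (z \<ominus> x \<otimes> r) \<oplus> x \<otimes> r"
          using zc xc r by (simp add: minus_eq a_assoc l_neg)
        ultimately show "z \<in> ?S" using r by blast
      qed
    qed
  qed
qed

text \<open>By induction along the filtration: at an index outside the common set neither ideal
  grows, and at an index inside it both acquire a direct summand isomorphic to
  \<open>e R\<close>.\<close>

lemma iso_right_if_lead_eq:
  assumes I: "right_ideal I R" and J: "right_ideal J R" and eq: "lead I = lead J"
  shows "I \<sim>\<^sub>R J"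
proof -
  have "I \<inter> filt k \<sim>\<^sub>R J \<inter> filt k" if "k \<le> n" for k
    using that
  proof (induction k)
    case 0
    have "I \<inter> filt 0 = J \<inter> filt 0" using right_idealD(2) I J by (auto simp: filt_0)
    then show ?case by (simp add: iso_right_refl)
  next
    case (Suc k)
    then have IH: "I \<inter> filt k \<sim>\<^sub>R J \<inter> filt k" by simp
    show ?case
    proof (cases "k \<in> lead I")
      case False
      then show ?thesis using filt_Suc_Int eq Suc.prems IH by simp
    next
      case True
      obtain x where x: "x \<in> carrier R" "x \<otimes> e = x"
        "\<And>r. r \<in> carrier R \<Longrightarrow> x \<otimes> r \<in> I \<inter> filt k \<Longrightarrow> e \<otimes> r = \<zero>"
        "I \<inter> filt (Suc k) = {c \<oplus> x \<otimes> r |c r. c \<in> I \<inter> filt k \<and> r \<in> carrier R}"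
        using lead_generator[OF I True] by blast
      obtain y where y: "y \<in> carrier R" "y \<otimes> e = y"
        "\<And>r. r \<in> carrier R \<Longrightarrow> y \<otimes> r \<in> J \<inter> filt k \<Longrightarrow> e \<otimes> r = \<zero>"
        "J \<inter> filt (Suc k) = {c \<oplus> y \<otimes> r |c r. c \<in> J \<inter> filt k \<and> r \<in> carrier R}"
        using lead_generator[OF J] True eq by blast
      show ?thesis
        unfolding x(4) y(4)
        by (rule iso_right_direct_sum[OF right_ideal_filt_Int[OF I] right_ideal_filt_Int[OF J] IH
              x(1) y(1) e_closed x(2) y(2) x(3) y(3)])
    qed
  qed
  from this[of n] have "I \<inter> carrier R \<sim>\<^sub>R J \<inter> carrier R" by (simp add: filt_n)
  moreover have "I \<inter> carrier R = I" "J \<inter> carrier R = J" using right_idealD(1) I J by auto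
  ultimately show ?thesis by simp
qed

text \<open>Along a descending chain the sets \<open>lead (N i)\<close> shrink inside
  \<open>{..<n}\<close>. Once they are constant, the terms of the chain are isomorphic.\<close>

theorem isoartinian: "right_isoartinian R"
  unfolding right_isoartinian_def isoartinian_module_def
proof (intro conjI allI impI ring_axioms)
  fix N :: "nat \<Rightarrow> 'a set"
  assume "(\<forall>i. submodule (N i) R (right_regular R)) \<and> (\<forall>i. N (Suc i) \<subseteq> N i)"
  then have N: "\<And>i. right_ideal (N i) R" "\<And>i. N (Suc i) \<subseteq> N i" by (auto simp: right_ideal_def)
  obtain m where m: "\<forall>i\<ge>m. lead (N i) = lead (N m)"
    using decreasing_chain_stabilises[of "\<lambda>i. lead (N i)", OF lead_mono[OF N(2)]]
      finite_subset[OF lead_subset] by auto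
  show "\<exists>m. \<forall>i\<ge>m. N i \<sim>\<^sub>R N m"
    by (intro exI[of _ m] allI impI iso_right_if_lead_eq N(1)) (rule m[rule_format])
qed

end

section \<open>Chain conditions when the corner is a division ring\<close>

locale division_frame = matrix_frame +
  assumes corner_inverse: "\<lbrakk>c \<in> carrier R; e \<otimes> c \<otimes> e = c; c \<noteq> \<zero>\<rbrakk> \<Longrightarrow>
    \<exists>c'\<in>carrier R. c \<otimes> c' = e \<and> c' \<otimes> c = e"
begin

text \<open>A nonzero element of \<open>e R\<close> has a nonzero entry
  \<open>x \<otimes> a i\<close>, which lies in \<open>e R e\<close> and can be inverted there. Thus
  every nonzero element of \<open>e R\<close> generates \<open>e R\<close>.\<close>

lemma right_inverse:
  assumes x: "x \<in> carrier R" "e \<otimes> x = x" "x \<noteq> \<zero>"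
  shows "\<exists>y\<in>carrier R. x \<otimes> y = e"
proof -
  obtain i where i: "i < n" "x \<otimes> a i \<noteq> \<zero>" using eq_zeroI_a x by blast
  have "e \<otimes> (x \<otimes> a i) \<otimes> e = (e \<otimes> x) \<otimes> (a i \<otimes> e)" using x(1) i by (simp add: m_assoc)
  then have "e \<otimes> (x \<otimes> a i) \<otimes> e = x \<otimes> a i" using x i a_e by simp
  then obtain c' where "c' \<in> carrier R" "x \<otimes> a i \<otimes> c' = e"
    using corner_inverse[of "x \<otimes> a i"] x i by auto
  then show ?thesis using x i by (intro bexI[of _ "a i \<otimes> c'"]) (auto simp: m_assoc)
qed

text \<open>Gaussian elimination along the filtration: a nonzero row \<open>k\<close> of an element
  of \<open>I\<close> can be scaled to row \<open>k\<close> of any \<open>z\<close> in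
  \<open>J\<close>, and the difference lies in the preceding filtration step.\<close>

lemma subset_if_lead_subset:
  assumes I: "right_ideal I R" and J: "right_ideal J R" and "I \<subseteq> J" and lead: "lead J \<subseteq> lead I"
  shows "J \<subseteq> I"
proof -
  note Ic = right_idealD[OF I] and Jc = right_idealD[OF J]
  have "J \<inter> filt k \<subseteq> I" if "k \<le> n" for k
    using that
  proof (induction k)
    case 0
    then show ?case using Ic by (auto simp: filt_0)
  next
    case (Suc k)
    then have kn: "k < n" and IH: "J \<inter> filt k \<subseteq> I" by auto
    show ?case
    proof
      fix z assume z: "z \<in> J \<inter> filt (Suc k)"
      show "z \<in> I"
      proof (cases "k \<in> lead I")
        case False
        then show ?thesis using z lead IH filt_Suc_Int[OF kn, of J] by blast
      next
        case True
        then obtain x where x: "x \<in> I" "x \<in> filt (Suc k)" "b k \<otimes> x \<noteq> \<zero>"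
          by (auto simp: lead_def)
        have c: "x \<in> carrier R" "z \<in> carrier R" using x z Ic Jc by auto
        obtain y where y: "y \<in> carrier R" "b k \<otimes> x \<otimes> y = e"
          using right_inverse[of "b k \<otimes> x"] x c kn e_b[of k] by (auto simp flip: m_assoc)
        \<comment> \<open>Right multiplication first turns row \<open>k\<close> of \<open>x\<close>
          into \<open>e\<close> and then into row \<open>k\<close> of \<open>z\<close>; the later
          rows stay zero.\<close>
        define w where "w = x \<otimes> (y \<otimes> (b k \<otimes> z))"
        have wI: "w \<in> I" using x y c kn Ic by (simp add: w_def)
        have wc: "w \<in> carrier R" using wI Ic by blast
        have "b k \<otimes> w = (b k \<otimes> x \<otimes> y) \<otimes> (b k \<otimes> z)"
          using c y(1) kn by (simp add: w_def m_assoc)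
        then have bw: "b k \<otimes> w = b k \<otimes> z"
          using y kn e_b[of k] c by (simp flip: m_assoc)
        have bj: "b j \<otimes> w = \<zero>" if "Suc k \<le> j" "j < n" for j
        proof -
          have "b j \<otimes> w = (b j \<otimes> x) \<otimes> (y \<otimes> (b k \<otimes> z))"
            using c y that kn by (simp add: w_def m_assoc)
          then show ?thesis using x(2) that c y kn by (simp add: filt_def)
        qed
        have "b j \<otimes> (z \<ominus> w) = \<zero>" if j: "k \<le> j" "j < n" for j
        proof (cases "j = k")
          case True
          then show ?thesis using bw c wc kn by (simp add: minus_eq r_distr r_minus r_neg)
        next
          case False
          moreover have "b j \<otimes> z = \<zero>" using z j False by (auto simp: filt_def)
          ultimately show ?thesis using bj[of j] j c wc by (simp add: minus_eq r_distr r_minus)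
        qed
        then have "z \<ominus> w \<in> J \<inter> filt k"
          using z wI \<open>I \<subseteq> J\<close> Jc c wc by (auto simp: filt_def)
        then have "z \<ominus> w \<oplus> w \<in> I" using IH wI Ic by blast
        moreover have "z \<ominus> w \<oplus> w = z" using c wc by (simp add: minus_eq a_assoc l_neg)
        ultimately show ?thesis by simp
      qed
    qed
  qed
  from this[of n] show ?thesis using Jc by (auto simp: filt_n)
qed

theorem artinian: "right_artinian R"
  unfolding right_artinian_def artinian_module_def
proof (intro conjI allI impI ring_axioms)
  fix N :: "nat \<Rightarrow> 'a set"
  assume "(\<forall>i. submodule (N i) R (right_regular R)) \<and> (\<forall>i. N (Suc i) \<subseteq> N i)"
  then have N: "\<And>i. right_ideal (N i) R" "\<And>i. N (Suc i) \<subseteq> N i" by (auto simp: right_ideal_def)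
  obtain m where m: "\<forall>i\<ge>m. lead (N i) = lead (N m)"
    using decreasing_chain_stabilises[of "\<lambda>i. lead (N i)", OF lead_mono[OF N(2)]]
      finite_subset[OF lead_subset] by auto
  have "N i = N m" if "i \<ge> m" for i
  proof
    show sub: "N i \<subseteq> N m" using that N(2) by (rule lift_Suc_antimono_le[rotated])
    show "N m \<subseteq> N i"
      using subset_if_lead_subset[OF N(1) N(1) sub equalityD1[OF m[rule_format, OF that, symmetric]]] .
  qed
  then show "\<exists>m. \<forall>i\<ge>m. N i = N m" by blast
qed

theorem noetherian: "right_noetherian R"
  unfolding right_noetherian_def noetherian_module_def
proof (intro conjI allI impI ring_axioms)
  fix N :: "nat \<Rightarrow> 'a set"
  assume "(\<forall>i. submodule (N i) R (right_regular R)) \<and> (\<forall>i. N i \<subseteq> N (Suc i))"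
  then have N: "\<And>i. right_ideal (N i) R" "\<And>i. N i \<subseteq> N (Suc i)" by (auto simp: right_ideal_def)
  \<comment> \<open>The sets \<open>lead (N i)\<close> now grow, so stabilisation is applied to
    their complements.\<close>
  obtain m where m: "\<forall>i\<ge>m. {..<n} - lead (N i) = {..<n} - lead (N m)"
    using decreasing_chain_stabilises[of "\<lambda>i. {..<n} - lead (N i)", OF Diff_mono[OF order_refl lead_mono[OF N(2)]]]
    by auto
  have "N i = N m" if "i \<ge> m" for i
  proof
    show sub: "N m \<subseteq> N i" using that N(2) by (rule lift_Suc_mono_le[rotated])
    have "lead (N i) = lead (N m)" using m that lead_subset by blast
    then show "N i \<subseteq> N m" using subset_if_lead_subset[OF N(1) N(1) sub] by auto
  qed
  then show "\<exists>m. \<forall>i\<ge>m. N i = N m" by blast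
qed

end

section \<open>Opposite rings and the chain condition on left ideals\<close>

definition opposite_ring :: "('a, 'm) ring_scheme \<Rightarrow> ('a, 'm) ring_scheme" where
  "opposite_ring R = R\<lparr>monoid.mult := \<lambda>x y. y \<otimes>\<^bsub>R\<^esub> x\<rparr>"

lemma opposite_ring_simps [simp]:
  "carrier (opposite_ring R) = carrier R"
  "x \<otimes>\<^bsub>opposite_ring R\<^esub> y = y \<otimes>\<^bsub>R\<^esub> x"
  "x \<oplus>\<^bsub>opposite_ring R\<^esub> y = x \<oplus>\<^bsub>R\<^esub> y"
  "\<zero>\<^bsub>opposite_ring R\<^esub> = \<zero>\<^bsub>R\<^esub>" "\<one>\<^bsub>opposite_ring R\<^esub> = \<one>\<^bsub>R\<^esub>"
  "finsum (opposite_ring R) f A = finsum R f A"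
  by (simp_all add: opposite_ring_def finsum_def)

lemma opposite_ring_is_ring:
  assumes "ring R"
  shows "ring (opposite_ring R)"
proof -
  interpret ring R by fact
  show ?thesis
  proof (rule ringI)
    show "abelian_group (opposite_ring R)"
      by (rule abelian_groupI) (auto simp: a_ac intro: bexI[of _ "\<ominus>\<^bsub>R\<^esub> _"] l_neg)
    show "monoid (opposite_ring R)"
      by (rule monoidI) (auto simp: m_assoc)
  qed (auto simp: l_distr r_distr)
qed

text \<open>Scalars are written first in both module structures, so a left ideal of \<open>R\<close>
  satisfies literally the same conditions as a right ideal of the opposite ring.\<close>

lemma left_artinian_iff_opposite:
  assumes "ring R"
  shows "left_artinian R \<longleftrightarrow> right_artinian (opposite_ring R)"
proof -
  have "submodule N R (left_regular R) \<longleftrightarrow>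
      submodule N (opposite_ring R) (right_regular (opposite_ring R))" for N
    by (simp add: submodule_def submodule_axioms_def left_regular_def right_regular_def
        opposite_ring_def)
  then show ?thesis
    using assms opposite_ring_is_ring[OF assms]
    by (simp add: left_artinian_def right_artinian_def artinian_module_def)
qed

context division_frame
begin

theorem left_artinian: "left_artinian R"
proof -
  interpret op: ring "opposite_ring R" by (rule opposite_ring_is_ring) (rule ring_axioms)
  \<comment> \<open>Reversing the multiplication and exchanging \<open>a\<close> with
    \<open>b\<close> permutes the axioms of a frame.\<close>
  interpret op: division_frame "opposite_ring R" n b a e
    using corner_inverse
    by unfold_locales (auto simp: e_idem a_e e_b b_a a_b m_assoc)
  show ?thesis using op.artinian left_artinian_iff_opposite[OF ring_axioms] by simp
qed

end

section \<open>Matrix rings\<close>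

text \<open>\<open>\<delta>\<close> identifies a ring \<open>D\<close> with the corner \<open>e R e\<close>.\<close>

locale frame_over = matrix_frame R n a b e + D: ring D
  for R (structure) and n a b e and D (structure) +
  fixes \<delta>
  assumes \<delta>_closed [simp]: "c \<in> carrier D \<Longrightarrow> \<delta> c \<in> carrier R"
    and \<delta>_add: "c \<in> carrier D \<Longrightarrow> d \<in> carrier D \<Longrightarrow> \<delta> (c \<oplus>\<^bsub>D\<^esub> d) = \<delta> c \<oplus> \<delta> d"
    and \<delta>_mult: "c \<in> carrier D \<Longrightarrow> d \<in> carrier D \<Longrightarrow> \<delta> (c \<otimes>\<^bsub>D\<^esub> d) = \<delta> c \<otimes> \<delta> d"
    and \<delta>_one: "\<delta> \<one>\<^bsub>D\<^esub> = e"
    and \<delta>_inj: "inj_on \<delta> (carrier D)"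
    and \<delta>_surj: "r \<in> carrier R \<Longrightarrow> e \<otimes> r \<otimes> e = r \<Longrightarrow> r \<in> \<delta> ` carrier D"
begin

lemma \<delta>_zero: "\<delta> \<zero>\<^bsub>D\<^esub> = \<zero>"
  using \<delta>_add[of "\<zero>\<^bsub>D\<^esub>" "\<zero>\<^bsub>D\<^esub>"] add.l_cancel_one[of "\<delta> \<zero>\<^bsub>D\<^esub>" "\<delta> \<zero>\<^bsub>D\<^esub>"] by simp

lemma \<delta>_eq_zero: "c \<in> carrier D \<Longrightarrow> \<delta> c = \<zero> \<Longrightarrow> c = \<zero>\<^bsub>D\<^esub>"
  using inj_onD[OF \<delta>_inj, of c "\<zero>\<^bsub>D\<^esub>"] \<delta>_zero by simp

lemma \<delta>_e: "c \<in> carrier D \<Longrightarrow> \<delta> c \<otimes> e = \<delta> c" "c \<in> carrier D \<Longrightarrow> e \<otimes> \<delta> c = \<delta> c"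
  using \<delta>_mult[of c "\<one>\<^bsub>D\<^esub>"] \<delta>_mult[of "\<one>\<^bsub>D\<^esub>" c] \<delta>_one by auto

lemma entry:
  assumes "x \<in> carrier R" "e \<otimes> x = x" "i < n"
  obtains c where "c \<in> carrier D" "x \<otimes> a i = \<delta> c"
proof -
  have "e \<otimes> (x \<otimes> a i) \<otimes> e = (e \<otimes> x) \<otimes> (a i \<otimes> e)" using assms(1,3) by (simp add: m_assoc)
  then show thesis using \<delta>_surj[of "x \<otimes> a i"] assms a_e that by auto
qed

text \<open>The submodules of \<open>e R\<close> are governed by right ideals of \<open>D\<close>:
  all entries of elements of \<open>L\<close> lie in one principal right ideal of \<open>D\<close>,
  whose generator also generates \<open>L\<close>. That \<open>D\<close> is a domain gives the
  condition on the annihilator.\<close>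

lemma isosimple_frame:
  assumes "principal_right_ideal_domain D"
  shows "isosimple_frame R n a b e"
proof unfold_locales
  interpret D: principal_right_ideal_domain D by fact
  fix L assume L: "right_ideal L R" "L \<subseteq> e <# carrier R" "L \<noteq> {\<zero>}"
  note Lc = right_idealD[OF L(1)]
  have eL: "e \<otimes> x = x" if "x \<in> L" for x
  proof -
    obtain r where "r \<in> carrier R" "x = e \<otimes> r" using L(2) \<open>x \<in> L\<close> by (auto simp: l_coset_def)
    then show ?thesis using e_idem by (simp flip: m_assoc)
  qed
  \<comment> \<open>The part of \<open>L\<close> inside the corner, read in \<open>D\<close>. It
    contains all entries \<open>x \<otimes> a i\<close> of elements of \<open>L\<close>, since
    \<open>L\<close> is closed under right multiplication.\<close>
  let ?I = "{c \<in> carrier D. \<delta> c \<in> L}"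
  have "right_ideal ?I D"
    by (rule D.right_idealI) (auto simp: \<delta>_zero \<delta>_add \<delta>_mult Lc)
  then obtain d where d: "d \<in> carrier D" "?I = d <#\<^bsub>D\<^esub> carrier D"
    using D.right_ideal_principal by blast
  have "d \<otimes>\<^bsub>D\<^esub> \<one>\<^bsub>D\<^esub> \<in> d <#\<^bsub>D\<^esub> carrier D" unfolding l_coset_def by blast
  then have dL: "\<delta> d \<in> L" using d by auto
  have coord: "\<exists>c\<in>carrier D. x \<otimes> a i = \<delta> d \<otimes> \<delta> c" if x: "x \<in> L" and i: "i < n" for x i
  proof -
    obtain c where c: "c \<in> carrier D" "x \<otimes> a i = \<delta> c" using entry Lc(1) eL x i by metis
    then have "c \<in> ?I" using x i Lc(4)[of x "a i"] by auto
    then obtain c' where "c' \<in> carrier D" "c = d \<otimes>\<^bsub>D\<^esub> c'"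
      unfolding d(2) by (auto simp: l_coset_def)
    then show ?thesis using c d \<delta>_mult by auto
  qed
  have d_nz: "d \<noteq> \<zero>\<^bsub>D\<^esub>"
  proof
    assume "d = \<zero>\<^bsub>D\<^esub>"
    then have "x \<otimes> a i = \<zero>" if "x \<in> L" "i < n" for x i using coord[OF that] \<delta>_zero by auto
    then have "x = \<zero>" if "x \<in> L" for x using eq_zeroI_a Lc(1) that by blast
    then show False using L(3) Lc(2) by blast
  qed
  have "L = \<delta> d <# carrier R"
  proof
    show "\<delta> d <# carrier R \<subseteq> L" using dL Lc(4) by (auto simp: l_coset_def)
    have P: "right_ideal (\<delta> d <# carrier R) R" by (rule right_ideal_principal) (simp add: d)
    show "L \<subseteq> \<delta> d <# carrier R"
    proof
      fix x assume x: "x \<in> L"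
      \<comment> \<open>Each column contribution to \<open>x\<close> is a multiple of
        \<open>\<delta> d\<close>, and by \<open>frame_right\<close> these contributions add up to
        \<open>x\<close>.\<close>
      have "x \<otimes> a i \<otimes> b i \<in> \<delta> d <# carrier R" if i: "i < n" for i
      proof -
        obtain c where c: "c \<in> carrier D" "x \<otimes> a i = \<delta> d \<otimes> \<delta> c" using coord x i by blast
        then have "x \<otimes> a i \<otimes> b i = \<delta> d \<otimes> (\<delta> c \<otimes> b i)" using d i by (simp add: m_assoc)
        then show ?thesis using c i by (auto simp: l_coset_def)
      qed
      then have "(\<Oplus>i\<in>{..<n}. (x \<otimes> a i) \<otimes> b i) \<in> \<delta> d <# carrier R"
        by (intro right_ideal_finsum[OF P]) auto
      then show "x \<in> \<delta> d <# carrier R" using frame_right[OF Lc(1)[OF x]] by simp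
    qed
  qed
  \<comment> \<open>The entries of \<open>e \<otimes> y\<close> correspond to elements of
    \<open>D\<close> that \<open>d\<close> kills from the left; these vanish because
    \<open>d\<close> is nonzero.\<close>
  moreover have "e \<otimes> y = \<zero>" if y: "y \<in> carrier R" "\<delta> d \<otimes> y = \<zero>" for y
  proof (rule eq_zeroI_a)
    show "e \<otimes> y \<in> carrier R" using y by simp
    fix i assume i: "i < n"
    have "e \<otimes> (e \<otimes> y) = e \<otimes> y" using y e_idem by (simp flip: m_assoc)
    then obtain c where c: "c \<in> carrier D" "e \<otimes> y \<otimes> a i = \<delta> c" using entry[of "e \<otimes> y" i] y i by auto
    have "\<delta> (d \<otimes>\<^bsub>D\<^esub> c) = \<delta> d \<otimes> (e \<otimes> y \<otimes> a i)" using c d \<delta>_mult by simp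
    also have "\<dots> = (\<delta> d \<otimes> e) \<otimes> y \<otimes> a i" using d y i by (simp add: m_assoc)
    also have "\<dots> = \<zero>" using d y i \<delta>_e by simp
    finally have "d \<otimes>\<^bsub>D\<^esub> c = \<zero>\<^bsub>D\<^esub>" using \<delta>_eq_zero c d by simp
    then have "c = \<zero>\<^bsub>D\<^esub>" using D.integral c d d_nz by blast
    then show "e \<otimes> y \<otimes> a i = \<zero>" using c \<delta>_zero by simp
  qed
  ultimately show "\<exists>d\<in>L. d \<otimes> e = d \<and> L = d <# carrier R \<and>
      (\<forall>y\<in>carrier R. d \<otimes> y = \<zero> \<longrightarrow> e \<otimes> y = \<zero>)"
    using dL \<delta>_e d by blast
qed

lemma division_frame:
  assumes "division_ring D"
  shows "division_frame R n a b e"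
proof unfold_locales
  fix r assume r: "r \<in> carrier R" "e \<otimes> r \<otimes> e = r" "r \<noteq> \<zero>"
  then obtain c where c: "c \<in> carrier D" "r = \<delta> c" using \<delta>_surj by blast
  then have "c \<in> Units D" using assms r \<delta>_zero by (auto simp: division_ring_def)
  then obtain c' where "c' \<in> carrier D" "c \<otimes>\<^bsub>D\<^esub> c' = \<one>\<^bsub>D\<^esub>" "c' \<otimes>\<^bsub>D\<^esub> c = \<one>\<^bsub>D\<^esub>"
    by (auto simp: Units_def)
  then show "\<exists>r'\<in>carrier R. r \<otimes> r' = e \<and> r' \<otimes> r = e"
    using c \<delta>_mult \<delta>_one by (metis \<delta>_closed)
qed

end

section \<open>Matrix units and the standard frame of a matrix ring\<close>

definition matrix_unit :: "nat \<Rightarrow> ('a, 'm) ring_scheme \<Rightarrow> nat \<Rightarrow> nat \<Rightarrow> 'a \<Rightarrow> 'a mat" where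
  "matrix_unit n D i j c = mat n n (\<lambda>(k, l). if k = i \<and> l = j then c else \<zero>\<^bsub>D\<^esub>)"

context ring
begin

lemma matrix_carrier_iff:
  "A \<in> carrier (matrix_ring n R) \<longleftrightarrow>
     A \<in> carrier_mat n n \<and> (\<forall>i<n. \<forall>j<n. A $$ (i, j) \<in> carrier R)"
  by (simp add: matrix_ring_def)

lemma matrix_add_index:
  "i < n \<Longrightarrow> j < n \<Longrightarrow> (A \<oplus>\<^bsub>matrix_ring n R\<^esub> B) $$ (i, j) = A $$ (i, j) \<oplus> B $$ (i, j)"
  by (simp add: matrix_ring_def)

lemma matrix_mult_index:
  "i < n \<Longrightarrow> j < n \<Longrightarrow>
    (A \<otimes>\<^bsub>matrix_ring n R\<^esub> B) $$ (i, j) = (\<Oplus>k\<in>{..<n}. A $$ (i, k) \<otimes> B $$ (k, j))"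
  by (simp add: matrix_ring_def)

lemma matrix_zero_index: "i < n \<Longrightarrow> j < n \<Longrightarrow> \<zero>\<^bsub>matrix_ring n R\<^esub> $$ (i, j) = \<zero>"
  by (simp add: matrix_ring_def)

lemma matrix_one_index:
  "i < n \<Longrightarrow> j < n \<Longrightarrow> \<one>\<^bsub>matrix_ring n R\<^esub> $$ (i, j) = (if i = j then \<one> else \<zero>)"
  by (simp add: matrix_ring_def)

lemma matrix_eqI:
  assumes "A \<in> carrier (matrix_ring n R)" "B \<in> carrier (matrix_ring n R)"
    and "\<And>i j. i < n \<Longrightarrow> j < n \<Longrightarrow> A $$ (i, j) = B $$ (i, j)"
  shows "A = B"
  using assms by (intro eq_matI) (auto simp: matrix_carrier_iff)

lemma matrix_finsum_index:
  assumes "finite K" "\<And>k. k \<in> K \<Longrightarrow> f k \<in> carrier (matrix_ring n R)" "i < n" "j < n"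
  shows "finsum (matrix_ring n R) f K $$ (i, j) = (\<Oplus>k\<in>K. f k $$ (i, j))"
  using assms(1,2)
proof (induction K rule: finite_induct)
  interpret M: ring "matrix_ring n R" by (rule matrix_ring_is_ring) (rule ring_axioms)
  case empty
  show ?case using matrix_zero_index assms(3,4) by simp
next
  interpret M: ring "matrix_ring n R" by (rule matrix_ring_is_ring) (rule ring_axioms)
  case (insert x F)
  have "finsum (matrix_ring n R) f (insert x F) = f x \<oplus>\<^bsub>matrix_ring n R\<^esub> finsum (matrix_ring n R) f F"
    using insert by (intro M.finsum_insert) auto
  moreover have "(\<Oplus>k\<in>insert x F. f k $$ (i, j)) = f x $$ (i, j) \<oplus> (\<Oplus>k\<in>F. f k $$ (i, j))"
    using insert assms(3,4) by (intro finsum_insert) (auto simp: matrix_carrier_iff)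
  ultimately show ?case using insert assms(3,4) by (simp add: matrix_add_index)
qed

lemma matrix_unit_index:
  "k < n \<Longrightarrow> l < n \<Longrightarrow> matrix_unit n R i j c $$ (k, l) = (if k = i \<and> l = j then c else \<zero>)"
  by (simp add: matrix_unit_def)

lemma matrix_unit_closed [simp]:
  "c \<in> carrier R \<Longrightarrow> matrix_unit n R i j c \<in> carrier (matrix_ring n R)"
  by (auto simp: matrix_carrier_iff matrix_unit_index) (simp add: matrix_unit_def)

lemma finsum_delta:
  fixes i n :: nat
  assumes "i < n" "c \<in> carrier R"
  shows "(\<Oplus>k\<in>{..<n}. if k = i then c else \<zero>) = c"
proof -
  have "(\<lambda>k. if k = i then c else \<zero>) = (\<lambda>k. if i = k then c else \<zero>)" by auto
  then show ?thesis using add.finprod_singleton[of i "{..<n}" "\<lambda>_. c"] assms by auto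
qed

lemma matrix_unit_mult:
  assumes c: "c \<in> carrier R" "d \<in> carrier R" and lt: "j < n" "k < n"
  shows "matrix_unit n R i j c \<otimes>\<^bsub>matrix_ring n R\<^esub> matrix_unit n R k l d =
    (if j = k then matrix_unit n R i l (c \<otimes> d) else \<zero>\<^bsub>matrix_ring n R\<^esub>)"
proof (rule matrix_eqI)
  interpret M: ring "matrix_ring n R" by (rule matrix_ring_is_ring) (rule ring_axioms)
  show "matrix_unit n R i j c \<otimes>\<^bsub>matrix_ring n R\<^esub> matrix_unit n R k l d \<in> carrier (matrix_ring n R)"
    using c by simp
  show "(if j = k then matrix_unit n R i l (c \<otimes> d) else \<zero>\<^bsub>matrix_ring n R\<^esub>)
      \<in> carrier (matrix_ring n R)" using c by simp
  fix p q assume pq: "p < n" "q < n"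
  let ?v = "if p = i \<and> j = k \<and> q = l then c \<otimes> d else \<zero>"
  have "(\<Oplus>m\<in>{..<n}. matrix_unit n R i j c $$ (p, m) \<otimes> matrix_unit n R k l d $$ (m, q)) =
      (\<Oplus>m\<in>{..<n}. if m = j then ?v else \<zero>)"
    using pq c by (intro finsum_cong') (auto simp: matrix_unit_index)
  also have "\<dots> = ?v" using lt c by (intro finsum_delta) auto
  finally show "(matrix_unit n R i j c \<otimes>\<^bsub>matrix_ring n R\<^esub> matrix_unit n R k l d) $$ (p, q) =
      (if j = k then matrix_unit n R i l (c \<otimes> d) else \<zero>\<^bsub>matrix_ring n R\<^esub>) $$ (p, q)"
    using pq by (simp add: matrix_mult_index matrix_unit_index matrix_zero_index)
qed

text \<open>The identification \<open>\<delta>\<close> sends a scalar to the matrix with that scalar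
  at position \<open>(0, 0)\<close>. The bound on \<open>n\<close> supplies the base index
  \<open>0\<close>.\<close>

lemma matrix_frame_over:
  assumes n: "n \<ge> 1"
  shows "frame_over (matrix_ring n R) n (\<lambda>i. matrix_unit n R i 0 \<one>) (\<lambda>i. matrix_unit n R 0 i \<one>)
    (matrix_unit n R 0 0 \<one>) R (matrix_unit n R 0 0)"
proof -
  interpret M: ring "matrix_ring n R" by (rule matrix_ring_is_ring) (rule ring_axioms)
  let ?E = "matrix_unit n R"
  have n0: "0 < n" using n by simp
  show ?thesis
  proof unfold_locales
    fix i j assume ij: "i < n" "j < n"
    show "?E 0 i \<one> \<otimes>\<^bsub>matrix_ring n R\<^esub> ?E j 0 \<one> =
        (if i = j then ?E 0 0 \<one> else \<zero>\<^bsub>matrix_ring n R\<^esub>)"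
      using ij by (simp add: matrix_unit_mult)
  next
    show "(\<Oplus>\<^bsub>matrix_ring n R\<^esub>i\<in>{..<n}. ?E i 0 \<one> \<otimes>\<^bsub>matrix_ring n R\<^esub> ?E 0 i \<one>) = \<one>\<^bsub>matrix_ring n R\<^esub>"
      (is "?s = _")
    proof (rule matrix_eqI)
      show "?s \<in> carrier (matrix_ring n R)" by (intro M.finsum_closed) auto
      show "\<one>\<^bsub>matrix_ring n R\<^esub> \<in> carrier (matrix_ring n R)" by simp
      fix p q assume pq: "p < n" "q < n"
      have "?s $$ (p, q) = (\<Oplus>k\<in>{..<n}. (?E k 0 \<one> \<otimes>\<^bsub>matrix_ring n R\<^esub> ?E 0 k \<one>) $$ (p, q))"
        using pq by (intro matrix_finsum_index) auto
      also have "\<dots> = (\<Oplus>k\<in>{..<n}. if k = p then (if p = q then \<one> else \<zero>) else \<zero>)"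
        using pq n0 by (intro finsum_cong') (auto simp: matrix_unit_mult matrix_unit_index)
      also have "\<dots> = (if p = q then \<one> else \<zero>)" using pq by (intro finsum_delta) auto
      finally show "?s $$ (p, q) = \<one>\<^bsub>matrix_ring n R\<^esub> $$ (p, q)" using pq by (simp add: matrix_one_index)
    qed
  next
    fix c d assume cd: "c \<in> carrier R" "d \<in> carrier R"
    show "?E 0 0 (c \<oplus> d) = ?E 0 0 c \<oplus>\<^bsub>matrix_ring n R\<^esub> ?E 0 0 d"
      using cd by (intro matrix_eqI) (auto simp: matrix_unit_index matrix_add_index)
  next
    show "inj_on (?E 0 0) (carrier R)"
    proof (rule inj_onI)
      fix c d assume "?E 0 0 c = ?E 0 0 d"
      then have "?E 0 0 c $$ (0, 0) = ?E 0 0 d $$ (0, 0)" by simp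
      then show "c = d" using n0 by (simp add: matrix_unit_index)
    qed
  next
    fix A assume A: "A \<in> carrier (matrix_ring n R)"
      and eq: "?E 0 0 \<one> \<otimes>\<^bsub>matrix_ring n R\<^esub> A \<otimes>\<^bsub>matrix_ring n R\<^esub> ?E 0 0 \<one> = A"
    have Ac: "A $$ (i, j) \<in> carrier R" if "i < n" "j < n" for i j
      using A that by (auto simp: matrix_carrier_iff)
    let ?B = "?E 0 0 \<one> \<otimes>\<^bsub>matrix_ring n R\<^esub> A"
    \<comment> \<open>Multiplication by the unit at \<open>(0, 0)\<close> on the left keeps only row
      \<open>0\<close>. On the right it will keep only column \<open>0\<close>, so a matrix fixed by
      both has at most one nonzero entry.\<close>
    have B: "?B $$ (p, q) = (if p = 0 then A $$ (0, q) else \<zero>)" if pq: "p < n" "q < n" for p q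
    proof -
      let ?v = "if p = 0 then A $$ (0, q) else \<zero>"
      have "?B $$ (p, q) = (\<Oplus>m\<in>{..<n}. if m = 0 then ?v else \<zero>)"
        unfolding matrix_mult_index[OF pq]
        using pq Ac n0 by (intro finsum_cong') (auto simp: matrix_unit_index)
      also have "\<dots> = ?v" using n0 pq Ac by (intro finsum_delta) auto
      finally show ?thesis .
    qed
    have "A = ?E 0 0 (A $$ (0, 0))"
    proof (rule matrix_eqI)
      show "A \<in> carrier (matrix_ring n R)" by fact
      show "?E 0 0 (A $$ (0, 0)) \<in> carrier (matrix_ring n R)" using Ac n0 by simp
      fix p q assume pq: "p < n" "q < n"
      let ?v = "if p = 0 \<and> q = 0 then A $$ (0, 0) else \<zero>"
      have "(?B \<otimes>\<^bsub>matrix_ring n R\<^esub> ?E 0 0 \<one>) $$ (p, q) = (\<Oplus>m\<in>{..<n}. if m = 0 then ?v else \<zero>)"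
        unfolding matrix_mult_index[OF pq]
        using pq Ac n0 by (intro finsum_cong') (auto simp: matrix_unit_index B)
      also have "\<dots> = ?v" using n0 Ac by (intro finsum_delta) auto
      finally show "A $$ (p, q) = ?E 0 0 (A $$ (0, 0)) $$ (p, q)"
        using eq pq by (simp add: matrix_unit_index)
    qed
    then show "A \<in> ?E 0 0 ` carrier R" using Ac n0 by blast
  qed (use n0 in \<open>simp_all add: matrix_unit_mult\<close>)
qed

end

text \<open>The data of a frame are elements satisfying equations, so the inverse isomorphism
  carries them back to \<open>R\<close>. Chain conditions are then proved in \<open>R\<close> itself
  and never transferred between rings.\<close>

lemma frame_over_transport:
  assumes "frame_over S n a b e D \<delta>" "ring R" and h: "h \<in> ring_iso R S"
  obtains a' b' e' \<delta>' where "frame_over R n a' b' e' D \<delta>'"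
proof -
  interpret S: frame_over S n a b e D \<delta> by fact
  interpret R: ring R by fact
  define g where "g = inv_into (carrier R) h"
  have g: "g \<in> ring_iso S R" unfolding g_def by (rule ring_iso_set_sym[OF assms(2) h])
  then have gm: "g \<in> Ring.ring_hom S R" and gbij: "bij_betw g (carrier S) (carrier R)"
    by (auto simp: ring_iso_def)
  interpret g: ring_hom_ring S R g
    by (intro ring_hom_ringI2 S.ring_axioms R.ring_axioms gm)
  have "frame_over R n (g \<circ> a) (g \<circ> b) (g e) D (g \<circ> \<delta>)"
  proof unfold_locales
    show "g e \<otimes>\<^bsub>R\<^esub> g e = g e" using S.e_idem by (simp flip: g.hom_mult)
    show "(\<Oplus>\<^bsub>R\<^esub>i\<in>{..<n}. (g \<circ> a) i \<otimes>\<^bsub>R\<^esub> (g \<circ> b) i) = \<one>\<^bsub>R\<^esub>"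
    proof -
      have "(\<Oplus>\<^bsub>R\<^esub>i\<in>{..<n}. (g \<circ> a) i \<otimes>\<^bsub>R\<^esub> (g \<circ> b) i) = (\<Oplus>\<^bsub>R\<^esub>i\<in>{..<n}. (g \<circ> (\<lambda>i. a i \<otimes>\<^bsub>S\<^esub> b i)) i)"
        by (intro R.finsum_cong') auto
      also have "\<dots> = g (\<Oplus>\<^bsub>S\<^esub>i\<in>{..<n}. a i \<otimes>\<^bsub>S\<^esub> b i)" by (subst g.hom_finsum) auto
      finally show ?thesis using S.a_b by simp
    qed
    show "inj_on (g \<circ> \<delta>) (carrier D)"
      using gbij S.\<delta>_inj by (intro comp_inj_on) (auto simp: bij_betw_def intro: inj_on_subset)
    fix r assume r: "r \<in> carrier R" "g e \<otimes>\<^bsub>R\<^esub> r \<otimes>\<^bsub>R\<^esub> g e = r"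
    then obtain s where s: "s \<in> carrier S" "r = g s" using gbij by (auto simp: bij_betw_def)
    have "g (e \<otimes>\<^bsub>S\<^esub> s \<otimes>\<^bsub>S\<^esub> e) = g s" using r s by simp
    then have "e \<otimes>\<^bsub>S\<^esub> s \<otimes>\<^bsub>S\<^esub> e = s"
      using inj_onD[OF bij_betw_imp_inj_on[OF gbij]] s by simp
    then have "s \<in> \<delta> ` carrier D" using S.\<delta>_surj s by blast
    then show "r \<in> (g \<circ> \<delta>) ` carrier D" using s by auto
  qed (auto simp: S.\<delta>_add S.\<delta>_mult S.\<delta>_one S.e_idem S.a_e S.e_b S.b_a simp flip: g.hom_mult)
  then show thesis by (rule that)
qed

section \<open>Corner rings\<close>

definition corner :: "('a, 'm) ring_scheme \<Rightarrow> 'a \<Rightarrow> 'a ring" where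
  "corner R e =
    \<lparr>carrier = {x \<in> carrier R. e \<otimes>\<^bsub>R\<^esub> x = x \<and> x \<otimes>\<^bsub>R\<^esub> e = x}, monoid.mult = monoid.mult R,
     one = e, ring.zero = \<zero>\<^bsub>R\<^esub>, add = add R\<rparr>"

lemma corner_simps [simp]:
  "x \<in> carrier (corner R e) \<longleftrightarrow> x \<in> carrier R \<and> e \<otimes>\<^bsub>R\<^esub> x = x \<and> x \<otimes>\<^bsub>R\<^esub> e = x"
  "x \<otimes>\<^bsub>corner R e\<^esub> y = x \<otimes>\<^bsub>R\<^esub> y" "x \<oplus>\<^bsub>corner R e\<^esub> y = x \<oplus>\<^bsub>R\<^esub> y"
  "\<one>\<^bsub>corner R e\<^esub> = e" "\<zero>\<^bsub>corner R e\<^esub> = \<zero>\<^bsub>R\<^esub>"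
  by (auto simp: corner_def)

lemma (in ring) corner_is_ring:
  assumes "e \<in> carrier R" "e \<otimes> e = e"
  shows "ring (corner R e)"
proof (rule ringI)
  show "abelian_group (corner R e)"
  proof (rule abelian_groupI)
    fix x assume "x \<in> carrier (corner R e)"
    then show "\<exists>y\<in>carrier (corner R e). y \<oplus>\<^bsub>corner R e\<^esub> x = \<zero>\<^bsub>corner R e\<^esub>"
      using assms by (intro bexI[of _ "\<ominus> x"]) (auto simp: l_neg l_minus r_minus)
  qed (use assms in \<open>auto simp: a_ac l_distr r_distr\<close>)
  show "monoid (corner R e)"
  proof (rule monoidI)
    fix x y assume *: "x \<in> carrier (corner R e)" "y \<in> carrier (corner R e)"
    then have "e \<otimes> (x \<otimes> y) = x \<otimes> y" using assms m_assoc[of e x y] by auto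
    then show "x \<otimes>\<^bsub>corner R e\<^esub> y \<in> carrier (corner R e)" using * assms by (auto simp: m_assoc)
  qed (use assms in \<open>auto simp: m_assoc\<close>)
qed (auto simp: l_distr r_distr)

lemma (in ring) finsum_corner:
  assumes e: "e \<in> carrier R" "e \<otimes> e = e" and "finite A"
    and "\<And>i. i \<in> A \<Longrightarrow> f i \<in> carrier (corner R e)"
  shows "finsum (corner R e) f A = finsum R f A"
  using assms(3,4)
proof (induction A rule: finite_induct)
  interpret C: ring "corner R e" by (rule corner_is_ring) fact+
  case empty
  then show ?case by simp
next
  interpret C: ring "corner R e" by (rule corner_is_ring) fact+
  case (insert x F)
  have "finsum (corner R e) f (insert x F) = f x \<oplus>\<^bsub>corner R e\<^esub> finsum (corner R e) f F"
    using insert by (intro C.finsum_insert) (auto simp del: corner_simps)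
  moreover have "finsum R f (insert x F) = f x \<oplus> finsum R f F"
    using insert by (intro finsum_insert) auto
  ultimately show ?case using insert by simp
qed

lemma (in ring) ideal_iff:
  "ideal I R \<longleftrightarrow> right_ideal I R \<and> (\<forall>x\<in>I. \<forall>r\<in>carrier R. r \<otimes> x \<in> I)"
proof
  assume "ideal I R"
  then interpret ideal I R .
  show "right_ideal I R \<and> (\<forall>x\<in>I. \<forall>r\<in>carrier R. r \<otimes> x \<in> I)"
    using I_l_closed I_r_closed a_subset by (auto intro!: right_idealI)
next
  assume *: "right_ideal I R \<and> (\<forall>x\<in>I. \<forall>r\<in>carrier R. r \<otimes> x \<in> I)"
  then have "subgroup I (add_monoid R)"
    using right_idealD[of I] by (intro add.subgroupI) (auto simp: a_inv_def)
  then show "ideal I R"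
    using * right_idealD(4) by (intro idealI ring_axioms) auto
qed

section \<open>A ring with a frame as the matrix ring over its corner\<close>

context matrix_frame
begin

lemma corner_ring: "ring (corner R e)"
  by (rule corner_is_ring) (auto simp: e_idem)

text \<open>By orthogonality of the frame, \<open>b k\<close> selects one summand. This and its dual
  read off the entries of an element assembled from rows or columns.\<close>

lemma b_mult_sum:
  assumes "k < n" "\<And>i. i < n \<Longrightarrow> y i \<in> carrier R"
  shows "b k \<otimes> (\<Oplus>i\<in>{..<n}. a i \<otimes> y i) = e \<otimes> y k"
proof -
  have "b k \<otimes> (\<Oplus>i\<in>{..<n}. a i \<otimes> y i) = (\<Oplus>i\<in>{..<n}. b k \<otimes> (a i \<otimes> y i))"
    using assms by (intro finsum_rdistr) auto
  also have "\<dots> = (\<Oplus>i\<in>{..<n}. if i = k then e \<otimes> y k else \<zero>)"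
    using assms by (intro finsum_cong') (auto simp: b_a simp flip: m_assoc)
  also have "\<dots> = e \<otimes> y k" using assms by (intro finsum_delta) auto
  finally show ?thesis .
qed

lemma sum_mult_a:
  assumes "k < n" "\<And>i. i < n \<Longrightarrow> y i \<in> carrier R"
  shows "(\<Oplus>i\<in>{..<n}. y i \<otimes> b i) \<otimes> a k = y k \<otimes> e"
proof -
  have "(\<Oplus>i\<in>{..<n}. y i \<otimes> b i) \<otimes> a k = (\<Oplus>i\<in>{..<n}. (y i \<otimes> b i) \<otimes> a k)"
    using assms by (intro finsum_ldistr) auto
  also have "\<dots> = (\<Oplus>i\<in>{..<n}. if i = k then y k \<otimes> e else \<zero>)"
    using assms by (intro finsum_cong') (auto simp: b_a m_assoc)
  also have "\<dots> = y k \<otimes> e" using assms by (intro finsum_delta) auto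
  finally show ?thesis .
qed

lemma entry_in_corner:
  assumes "r \<in> carrier R" "i < n" "j < n"
  shows "b i \<otimes> r \<otimes> a j \<in> carrier (corner R e)"
proof -
  have "e \<otimes> (b i \<otimes> r \<otimes> a j) = (e \<otimes> b i) \<otimes> r \<otimes> a j" "(b i \<otimes> r \<otimes> a j) \<otimes> e = b i \<otimes> r \<otimes> (a j \<otimes> e)"
    using assms by (simp_all add: m_assoc)
  then show ?thesis using assms by (simp add: e_b a_e)
qed

text \<open>The isomorphism sends \<open>r\<close> to the matrix with entries
  \<open>b i \<otimes> r \<otimes> a j\<close>. Inserting the sum of the
  \<open>a k \<otimes> b k\<close> between two factors shows multiplicativity, and the preimage of
  \<open>A\<close> is the double sum of
  \<open>a i \<otimes> A $$ (i, j) \<otimes> b j\<close>.\<close>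

theorem iso_matrix_ring: "R \<simeq> matrix_ring n (corner R e)"
proof -
  let ?C = "corner R e"
  interpret C: ring ?C by (rule corner_ring)
  interpret M: ring "matrix_ring n ?C" by (rule matrix_ring_is_ring) (rule corner_ring)
  define h where "h r = mat n n (\<lambda>(i, j). b i \<otimes> r \<otimes> a j)" for r
  have h_index: "h r $$ (i, j) = b i \<otimes> r \<otimes> a j" if "i < n" "j < n" for r i j
    using that by (simp add: h_def)
  have h_closed: "h r \<in> carrier (matrix_ring n ?C)" if "r \<in> carrier R" for r
    using entry_in_corner[OF that] by (auto simp: C.matrix_carrier_iff h_index simp del: corner_simps)
      (simp add: h_def)
  have "h \<in> ring_iso R (matrix_ring n ?C)"
  proof (rule ring_iso_memI)
    show "h r \<in> carrier (matrix_ring n ?C)" if "r \<in> carrier R" for r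
      using h_closed that .
    show "h (r \<otimes> s) = h r \<otimes>\<^bsub>matrix_ring n ?C\<^esub> h s" if rs: "r \<in> carrier R" "s \<in> carrier R" for r s
    proof (rule C.matrix_eqI)
      show "h (r \<otimes> s) \<in> carrier (matrix_ring n ?C)" using h_closed rs by simp
      show "h r \<otimes>\<^bsub>matrix_ring n ?C\<^esub> h s \<in> carrier (matrix_ring n ?C)" using h_closed rs by simp
      fix i j assume ij: "i < n" "j < n"
      have "(h r \<otimes>\<^bsub>matrix_ring n ?C\<^esub> h s) $$ (i, j)
          = finsum ?C (\<lambda>k. (b i \<otimes> r \<otimes> a k) \<otimes>\<^bsub>?C\<^esub> (b k \<otimes> s \<otimes> a j)) {..<n}"
        unfolding C.matrix_mult_index[OF ij]
        using ij rs entry_in_corner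
        by (intro C.finsum_cong' refl) (auto simp: h_index simp del: corner_simps intro!: C.m_closed)
      \<comment> \<open>The matrix product sums in the corner. The sum is moved to \<open>R\<close>,
        since the common factor \<open>b i \<otimes> r\<close> to be taken out need not lie in the
        corner.\<close>
      also have "\<dots> = (\<Oplus>k\<in>{..<n}. (b i \<otimes> r \<otimes> a k) \<otimes>\<^bsub>?C\<^esub> (b k \<otimes> s \<otimes> a j))"
        using ij rs entry_in_corner
        by (intro finsum_corner) (auto simp: e_idem simp del: corner_simps intro!: C.m_closed)
      also have "\<dots> = (\<Oplus>k\<in>{..<n}. (b i \<otimes> r) \<otimes> (a k \<otimes> (b k \<otimes> (s \<otimes> a j))))"
        using ij rs by (intro finsum_cong') (auto simp: m_assoc)
      also have "\<dots> = b i \<otimes> r \<otimes> (\<Oplus>k\<in>{..<n}. a k \<otimes> (b k \<otimes> (s \<otimes> a j)))"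
        using ij rs by (intro finsum_rdistr[symmetric]) auto
      also have "\<dots> = b i \<otimes> r \<otimes> (s \<otimes> a j)"
        using frame_left[of "s \<otimes> a j"] ij rs by simp
      also have "\<dots> = h (r \<otimes> s) $$ (i, j)" using ij rs by (simp add: h_index m_assoc)
      finally show "h (r \<otimes> s) $$ (i, j) = (h r \<otimes>\<^bsub>matrix_ring n ?C\<^esub> h s) $$ (i, j)" by simp
    qed
    show "h (r \<oplus> s) = h r \<oplus>\<^bsub>matrix_ring n ?C\<^esub> h s" if rs: "r \<in> carrier R" "s \<in> carrier R" for r s
    proof (rule C.matrix_eqI)
      show "h (r \<oplus> s) \<in> carrier (matrix_ring n ?C)" using h_closed rs by simp
      show "h r \<oplus>\<^bsub>matrix_ring n ?C\<^esub> h s \<in> carrier (matrix_ring n ?C)" using h_closed rs by simp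
      fix i j assume ij: "i < n" "j < n"
      show "h (r \<oplus> s) $$ (i, j) = (h r \<oplus>\<^bsub>matrix_ring n ?C\<^esub> h s) $$ (i, j)"
        using ij rs by (simp add: h_index C.matrix_add_index l_distr r_distr)
    qed
    show "h \<one> = \<one>\<^bsub>matrix_ring n ?C\<^esub>"
    proof (rule C.matrix_eqI)
      show "h \<one> \<in> carrier (matrix_ring n ?C)" using h_closed by simp
      show "\<one>\<^bsub>matrix_ring n ?C\<^esub> \<in> carrier (matrix_ring n ?C)" by simp
      fix i j assume ij: "i < n" "j < n"
      show "h \<one> $$ (i, j) = \<one>\<^bsub>matrix_ring n ?C\<^esub> $$ (i, j)"
        using ij by (simp add: h_index C.matrix_one_index b_a)
    qed
    show "bij_betw h (carrier R) (carrier (matrix_ring n ?C))"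
    proof (rule bij_betw_imageI)
      show "inj_on h (carrier R)"
      proof (rule inj_onI)
        fix r s assume rs: "r \<in> carrier R" "s \<in> carrier R" "h r = h s"
        have "b i \<otimes> (r \<ominus> s) = \<zero>" if i: "i < n" for i
        proof (rule eq_zeroI_a)
          show "b i \<otimes> (r \<ominus> s) \<in> carrier R" using i rs by simp
          fix j assume j: "j < n"
          have "b i \<otimes> r \<otimes> a j = b i \<otimes> s \<otimes> a j" using h_index[OF i j] rs by metis
          then show "b i \<otimes> (r \<ominus> s) \<otimes> a j = \<zero>"
            using i j rs by (simp add: minus_eq r_distr l_distr r_minus l_minus r_neg)
        qed
        then have "r \<ominus> s = \<zero>" using eq_zeroI_b rs by simp
        then show "r = s" using rs by simp
      qed
      show "h ` carrier R = carrier (matrix_ring n ?C)"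
      proof
        show "h ` carrier R \<subseteq> carrier (matrix_ring n ?C)" using h_closed by blast
        show "carrier (matrix_ring n ?C) \<subseteq> h ` carrier R"
        proof
          fix A assume A: "A \<in> carrier (matrix_ring n ?C)"
          have Ac: "A $$ (i, j) \<in> carrier R" "e \<otimes> A $$ (i, j) = A $$ (i, j)"
            "A $$ (i, j) \<otimes> e = A $$ (i, j)" if "i < n" "j < n" for i j
            using A that by (auto simp: C.matrix_carrier_iff)
          \<comment> \<open>The preimage is assembled in two stages: \<open>y i\<close> is its row
            \<open>i\<close>, and \<open>r\<close> below puts the rows in place.\<close>
          define y where "y i = (\<Oplus>j\<in>{..<n}. A $$ (i, j) \<otimes> b j)" for i
          have yc: "y i \<in> carrier R" if "i < n" for i
            unfolding y_def using Ac that by (intro finsum_closed) auto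
          define r where "r = (\<Oplus>i\<in>{..<n}. a i \<otimes> y i)"
          have rc: "r \<in> carrier R" unfolding r_def using yc by (intro finsum_closed) auto
          have "A = h r"
          proof (rule C.matrix_eqI[OF A h_closed[OF rc]])
            fix i j assume ij: "i < n" "j < n"
            have "b i \<otimes> r \<otimes> a j = e \<otimes> y i \<otimes> a j"
              unfolding r_def using b_mult_sum[of i y] ij yc by simp
            also have "\<dots> = e \<otimes> (y i \<otimes> a j)" using ij yc by (simp add: m_assoc)
            also have "y i \<otimes> a j = A $$ (i, j) \<otimes> e"
              unfolding y_def using ij Ac by (intro sum_mult_a) auto
            finally show "A $$ (i, j) = h r $$ (i, j)" using ij Ac by (simp add: h_index)
          qed
          then show "A \<in> h ` carrier R" using rc by blast
        qed
      qed
    qed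
  qed
  then show ?thesis unfolding is_ring_iso_def by blast
qed

text \<open>An ideal of the corner is compared with an ideal \<open>T\<close> of \<open>R\<close>
  that contains it and satisfies \<open>e T e \<subseteq> I\<close>. If \<open>T\<close> is zero
  then so is \<open>I\<close>; if \<open>T\<close> is \<open>R\<close> then \<open>e\<close> lies in
  \<open>I\<close>.\<close>

lemma corner_simple:
  assumes "simple_ring R"
  shows "simple_ring (corner R e)"
  unfolding simple_ring_def
proof (intro conjI allI impI corner_ring)
  interpret C: ring "corner R e" by (rule corner_ring)
  fix I assume "ideal I (corner R e)"
  then have I: "right_ideal I (corner R e)"
    and I_l: "\<And>x r. x \<in> I \<Longrightarrow> r \<in> carrier (corner R e) \<Longrightarrow> r \<otimes> x \<in> I"
    by (auto simp: C.ideal_iff simp del: corner_simps(1))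
  note Ic = C.right_idealD[OF I, simplified]
  have ere: "e \<otimes> r \<otimes> e \<in> carrier (corner R e)" if "r \<in> carrier R" for r
  proof -
    have "e \<otimes> (e \<otimes> r \<otimes> e) = (e \<otimes> e) \<otimes> r \<otimes> e" "e \<otimes> r \<otimes> e \<otimes> e = e \<otimes> r \<otimes> (e \<otimes> e)"
      using that by (simp_all add: m_assoc)
    then show ?thesis using that by (simp add: e_idem)
  qed
  \<comment> \<open>The largest two-sided ideal of \<open>R\<close> whose compression by
    \<open>e\<close> on both sides lies in \<open>I\<close>.\<close>
  let ?T = "{x \<in> carrier R. \<forall>r\<in>carrier R. \<forall>s\<in>carrier R. e \<otimes> r \<otimes> x \<otimes> s \<otimes> e \<in> I}"
  have "ideal ?T R"
    unfolding ideal_iff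
  proof (intro conjI ballI right_idealI)
    show "\<zero> \<in> ?T" using Ic(2) by simp
  next
    fix x y assume "x \<in> ?T" "y \<in> ?T"
    then show "x \<oplus> y \<in> ?T" using Ic(3) by (auto simp: l_distr r_distr)
  next
    fix x t assume x: "x \<in> ?T" and t: "t \<in> carrier R"
    have "e \<otimes> r \<otimes> (x \<otimes> t) \<otimes> s \<otimes> e \<in> I" if "r \<in> carrier R" "s \<in> carrier R" for r s
    proof -
      have "e \<otimes> r \<otimes> (x \<otimes> t) \<otimes> s \<otimes> e = e \<otimes> r \<otimes> x \<otimes> (t \<otimes> s) \<otimes> e"
        using x t that by (simp add: m_assoc)
      then show ?thesis using x t that by simp
    qed
    then show "x \<otimes> t \<in> ?T" using x t by simp
    have "e \<otimes> r \<otimes> (t \<otimes> x) \<otimes> s \<otimes> e \<in> I" if "r \<in> carrier R" "s \<in> carrier R" for r s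
    proof -
      have "e \<otimes> r \<otimes> (t \<otimes> x) \<otimes> s \<otimes> e = e \<otimes> (r \<otimes> t) \<otimes> x \<otimes> s \<otimes> e"
        using x t that by (simp add: m_assoc)
      then show ?thesis using x t that by simp
    qed
    then show "t \<otimes> x \<in> ?T" using x t by simp
  qed auto
  then consider "?T = {\<zero>}" | "?T = carrier R" using assms by (auto simp: simple_ring_def)
  then show "I = {\<zero>\<^bsub>corner R e\<^esub>} \<or> I = carrier (corner R e)"
  proof cases
    case 1
    have "x = \<zero>" if x: "x \<in> I" for x
    proof -
      have xc: "x \<in> carrier R" "e \<otimes> x = x" "x \<otimes> e = x" using Ic(1)[OF x] by auto
      \<comment> \<open>Writing \<open>x = e \<otimes> x \<otimes> e\<close> turns the product into
        a multiple of \<open>x\<close> by corner elements on both sides; hence \<open>I\<close> is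
        contained in \<open>?T\<close>.\<close>
      have "e \<otimes> r \<otimes> x \<otimes> s \<otimes> e \<in> I" if rs: "r \<in> carrier R" "s \<in> carrier R" for r s
      proof -
        have "e \<otimes> r \<otimes> x \<otimes> s \<otimes> e = e \<otimes> r \<otimes> (e \<otimes> x \<otimes> e) \<otimes> s \<otimes> e" using xc by simp
        also have "\<dots> = (e \<otimes> r \<otimes> e) \<otimes> x \<otimes> (e \<otimes> s \<otimes> e)" using xc(1) rs by (simp add: m_assoc)
        also have "\<dots> \<in> I"
          using I_l[OF x ere[OF rs(1)]] ere[OF rs(2)] Ic(4) by simp
        finally show ?thesis .
      qed
      then have "x \<in> ?T" using xc by simp
      then show ?thesis using 1 by blast
    qed
    then have "I = {\<zero>}" using Ic(2) by blast
    then show ?thesis by simp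
  next
    case 2
    then have "\<one> \<in> ?T" by simp
    then have "e \<otimes> \<one> \<otimes> \<one> \<otimes> \<one> \<otimes> e \<in> I" by blast
    then have eI: "e \<in> I" by (simp add: e_idem)
    have "x \<in> I" if "x \<in> carrier (corner R e)" for x
      using Ic(4)[OF eI, of x] that by simp
    moreover have "I \<subseteq> carrier (corner R e)" using C.right_idealD(1)[OF I] by blast
    ultimately show ?thesis by blast
  qed
qed

end

section \<open>The corner of an isosimple frame is a principal right ideal domain\<close>

context isosimple_frame
begin

text \<open>
  Every submodule of \<open>e R\<close> is principal, so \<open>e R\<close> is noetherian. Dividing \<open>c\<close> by a generator of
  \<open>c R \<cong> e R\<close> gives a surjective endomorphism of \<open>e R\<close> with the same kernel as \<open>c\<close>; by the ascending
  chain condition on the kernels of its powers it is injective.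
\<close>

lemma corner_left_cancel:
  assumes c: "c \<in> carrier R" "e \<otimes> c = c" "c \<otimes> e = c" "c \<noteq> \<zero>"
    and y: "y \<in> carrier R" "c \<otimes> y = \<zero>"
  shows "e \<otimes> y = \<zero>"
proof -
  have sub: "c <# carrier R \<subseteq> e <# carrier R"
  proof
    fix z assume "z \<in> c <# carrier R"
    then obtain r where r: "r \<in> carrier R" "z = c \<otimes> r" by (auto simp: l_coset_def)
    then have "z = e \<otimes> (c \<otimes> r)" using c by (simp flip: m_assoc)
    then show "z \<in> e <# carrier R" using r c by (auto simp: l_coset_def)
  qed
  have "c \<otimes> \<one> \<in> c <# carrier R" unfolding l_coset_def by blast
  then have cc: "c \<in> c <# carrier R" using c by simp
  then have "c <# carrier R \<noteq> {\<zero>}" using c by blast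
  from isosimple[OF right_ideal_principal[OF c(1)] sub this]
  obtain d where d: "d \<in> c <# carrier R" "d \<otimes> e = d" "c <# carrier R = d <# carrier R"
    "\<And>y. y \<in> carrier R \<Longrightarrow> d \<otimes> y = \<zero> \<Longrightarrow> e \<otimes> y = \<zero>" by blast
  from d(1) obtain v where v: "v \<in> carrier R" "d = c \<otimes> v" by (auto simp: l_coset_def)
  have dc: "d \<in> carrier R" using v c by simp
  obtain w0 where w0: "w0 \<in> carrier R" "c = d \<otimes> w0" using cc d(3) by (auto simp: l_coset_def)
  \<comment> \<open>An arbitrary quotient \<open>w0\<close> of \<open>c\<close> by \<open>d\<close>
    is compressed to the corner, which keeps the equation \<open>c = d \<otimes> w\<close>.
    Multiplication by \<open>w\<close> is the endomorphism of \<open>e R\<close> to be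
    studied.\<close>
  define w where "w = e \<otimes> w0 \<otimes> e"
  have w: "w \<in> carrier R" using w0 by (simp add: w_def)
  have ew: "e \<otimes> w = w" using w0 e_idem by (simp add: w_def flip: m_assoc)
  have "d \<otimes> w = (d \<otimes> e) \<otimes> w0 \<otimes> e" using w0 dc by (simp add: w_def m_assoc)
  also have "\<dots> = c \<otimes> e" using w0(2) d(2) by simp
  finally have dw: "c = d \<otimes> w" using c(3) by simp
  have kernel: "w \<otimes> x = \<zero>" if x: "x \<in> carrier R" "c \<otimes> x = \<zero>" for x
  proof -
    have "d \<otimes> (w \<otimes> x) = \<zero>" using x dw w dc by (simp flip: m_assoc)
    then have "e \<otimes> (w \<otimes> x) = \<zero>" using d(4) w x by simp
    then show ?thesis using w x ew by (simp flip: m_assoc)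
  qed
  \<comment> \<open>From \<open>d = c \<otimes> v = d \<otimes> (w \<otimes> v)\<close> and the
    annihilator of \<open>d\<close> one gets \<open>w \<otimes> v = e\<close>. A right inverse of
    \<open>w\<close> in the corner makes multiplication by \<open>w\<close> surjective on
    \<open>e R\<close>.\<close>
  have wv: "w \<otimes> (e \<otimes> v \<otimes> e) = e"
  proof -
    have we: "w \<otimes> e = w" using w0 by (simp add: w_def m_assoc e_idem)
    have "d \<otimes> (w \<otimes> v) = d" using v(1) v(2) dw w dc by (simp flip: m_assoc)
    then have "d \<otimes> (w \<otimes> v \<ominus> e) = \<zero>"
      using d(2) dc w v(1) by (simp add: minus_eq r_distr r_minus r_neg)
    then have "e \<otimes> (w \<otimes> v \<ominus> e) = \<zero>" using d(4) w v(1) by simp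
    then have "e \<otimes> w \<otimes> v \<ominus> e = \<zero>"
      using w v(1) e_idem by (simp add: minus_eq r_distr r_minus m_assoc)
    then have "w \<otimes> v = e" using ew w v(1) by simp
    moreover have "w \<otimes> (e \<otimes> v \<otimes> e) = (w \<otimes> e) \<otimes> v \<otimes> e" using w v(1) by (simp add: m_assoc)
    ultimately show ?thesis using we e_idem by simp
  qed
  define x where "x = e \<otimes> y"
  have x: "x \<in> carrier R" "e \<otimes> x = x" using y e_idem by (simp_all add: x_def flip: m_assoc)
  have wx: "w \<otimes> x = \<zero>"
    using kernel[OF x(1)] c y unfolding x_def by (simp flip: m_assoc)
  have lift: "\<exists>z\<in>carrier R. e \<otimes> z = z \<and> w [^] m \<otimes> z = x" for m :: nat
  proof (induction m)
    case 0
    then show ?case using x by (intro bexI[of _ x]) auto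
  next
    case (Suc m)
    then obtain z where z: "z \<in> carrier R" "e \<otimes> z = z" "w [^] m \<otimes> z = x" by blast
    let ?z = "(e \<otimes> v \<otimes> e) \<otimes> z"
    have "w [^] Suc m \<otimes> ?z = w [^] m \<otimes> ((w \<otimes> (e \<otimes> v \<otimes> e)) \<otimes> z)"
      using w v(1) z(1) by (simp add: m_assoc)
    then have "w [^] Suc m \<otimes> ?z = x" using wv z by simp
    moreover have "e \<otimes> ?z = ?z" using v(1) z(1) e_idem by (simp flip: m_assoc)
    ultimately show ?case using v(1) z(1) by (intro bexI[of _ ?z]) auto
  qed
  define K where "K m = {z \<in> carrier R. e \<otimes> z = z \<and> w [^] m \<otimes> z = \<zero>}" for m :: nat
  have pow_Suc: "w [^] Suc m \<otimes> z = w \<otimes> (w [^] m \<otimes> z)" if "z \<in> carrier R" for m :: nat and z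
    using m_assoc[of w "w [^] m" z] nat_pow_Suc2[OF w, of m] w that by (simp del: nat_pow_Suc)
  have K_Suc: "K m \<subseteq> K (Suc m)" for m
  proof
    fix z assume z: "z \<in> K m"
    then have "w [^] Suc m \<otimes> z = \<zero>" unfolding K_def by (subst pow_Suc) (use w in auto)
    then show "z \<in> K (Suc m)" using z unfolding K_def by blast
  qed
  have K_mono: "K i \<subseteq> K j" if "i \<le> j" for i j
    using that K_Suc by (rule lift_Suc_mono_le[rotated])
  have "right_ideal (\<Union>m. K m) R"
  proof (rule right_idealI)
    show "\<zero> \<in> (\<Union>m. K m)" using w by (auto simp: K_def)
    fix s t assume "s \<in> (\<Union>m. K m)" "t \<in> (\<Union>m. K m)"
    then obtain i j where "s \<in> K i" "t \<in> K j" by blast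
    then have "s \<in> K (max i j)" "t \<in> K (max i j)" using K_mono[of i "max i j"] K_mono[of j "max i j"] by auto
    then have "s \<oplus> t \<in> K (max i j)" using w by (auto simp: K_def r_distr)
    then show "s \<oplus> t \<in> (\<Union>m. K m)" by blast
  next
    fix s r assume "s \<in> (\<Union>m. K m)" and r: "r \<in> carrier R"
    then obtain i where "s \<in> K i" by blast
    then have "s \<otimes> r \<in> K i" using w r by (auto simp: K_def simp flip: m_assoc)
    then show "s \<otimes> r \<in> (\<Union>m. K m)" by blast
  qed (auto simp: K_def)
  moreover have "(\<Union>m. K m) \<subseteq> e <# carrier R"
  proof
    fix s assume "s \<in> (\<Union>m. K m)"
    then have "s \<in> carrier R" "s = e \<otimes> s" by (auto simp: K_def)
    then show "s \<in> e <# carrier R" unfolding l_coset_def by blast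
  qed
  \<comment> \<open>A generator of the union of the kernels lies in a single \<open>K m\<close>,
    which then is the whole union. The zero union is treated apart because \<open>isosimple\<close>
    speaks only of nonzero submodules.\<close>
  ultimately have "\<exists>m. (\<Union>m. K m) \<subseteq> K m"
  proof (cases "(\<Union>m. K m) = {\<zero>}")
    case True
    then have "(\<Union>m. K m) \<subseteq> K 0" using w by (auto simp: K_def)
    then show ?thesis by blast
  next
    case False
    assume "right_ideal (\<Union>m. K m) R" "(\<Union>m. K m) \<subseteq> e <# carrier R"
    from isosimple[OF this False]
    obtain k where k: "k \<in> (\<Union>m. K m)" "(\<Union>m. K m) = k <# carrier R" by blast
    then obtain m where m: "k \<in> K m" by blast
    have "k <# carrier R \<subseteq> K m"
      using m w by (auto simp: K_def l_coset_def simp flip: m_assoc)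
    then show ?thesis using k(2) by auto
  qed
  \<comment> \<open>Lifting \<open>x\<close> through the power \<open>m\<close> of \<open>w\<close>
    gives \<open>z\<close> in \<open>K (Suc m)\<close>, as \<open>w\<close> kills \<open>x\<close>.
    Then \<open>z\<close> is already in \<open>K m\<close>, which says that \<open>x\<close>
    vanishes.\<close>
  then obtain m where m: "K (Suc m) \<subseteq> K m" by blast
  obtain z where z: "z \<in> carrier R" "e \<otimes> z = z" "w [^] m \<otimes> z = x" using lift by blast
  have "w [^] Suc m \<otimes> z = \<zero>" using pow_Suc[OF z(1)] z(3) wx by metis
  then have "z \<in> K (Suc m)" using z unfolding K_def by blast
  then have "z \<in> K m" using m by blast
  then show ?thesis using z(3) by (simp add: K_def x_def)
qed

text \<open>Absence of zero divisors is \<open>corner_left_cancel\<close>. A right ideal of the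
  corner is extended to a submodule of \<open>e R\<close>, whose generator, being fixed by
  \<open>e\<close> on both sides, lies in the corner and generates the original right ideal.\<close>

theorem corner_principal_right_ideal_domain:
  assumes "e \<noteq> \<zero>"
  shows "principal_right_ideal_domain (corner R e)"
proof -
  interpret C: ring "corner R e" by (rule corner_ring)
  show ?thesis
  proof unfold_locales
    show "\<one>\<^bsub>corner R e\<^esub> \<noteq> \<zero>\<^bsub>corner R e\<^esub>" using assms by simp
  next
    fix c d assume "c \<in> carrier (corner R e)" "d \<in> carrier (corner R e)"
      "c \<otimes>\<^bsub>corner R e\<^esub> d = \<zero>\<^bsub>corner R e\<^esub>"
    then show "c = \<zero>\<^bsub>corner R e\<^esub> \<or> d = \<zero>\<^bsub>corner R e\<^esub>"
      using corner_left_cancel[of c d] by auto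
  next
    fix I assume I: "right_ideal I (corner R e)"
    note Ic = C.right_idealD[OF I, simplified]
    \<comment> \<open>The largest submodule of \<open>e R\<close> whose right multiples by
      \<open>e\<close> lie in \<open>I\<close>.\<close>
    let ?L = "{x \<in> carrier R. e \<otimes> x = x \<and> (\<forall>r\<in>carrier R. x \<otimes> r \<otimes> e \<in> I)}"
    have ere: "e \<otimes> (e \<otimes> r \<otimes> e) = e \<otimes> r \<otimes> e \<and> e \<otimes> r \<otimes> e \<otimes> e = e \<otimes> r \<otimes> e" if "r \<in> carrier R" for r
    proof -
      have "e \<otimes> (e \<otimes> r \<otimes> e) = (e \<otimes> e) \<otimes> r \<otimes> e" "e \<otimes> r \<otimes> e \<otimes> e = e \<otimes> r \<otimes> (e \<otimes> e)"
        using that by (simp_all add: m_assoc)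
      then show ?thesis by (simp add: e_idem)
    qed
    have L: "right_ideal ?L R"
    proof (rule right_idealI)
      show "\<zero> \<in> ?L" using Ic(2) by simp
      fix x y assume "x \<in> ?L" "y \<in> ?L"
      then show "x \<oplus> y \<in> ?L" using Ic(3) by (auto simp: l_distr r_distr)
    next
      fix x t assume x: "x \<in> ?L" and t: "t \<in> carrier R"
      have "e \<otimes> (x \<otimes> t) = x \<otimes> t" using x t by (simp flip: m_assoc)
      moreover have "x \<otimes> t \<otimes> r \<otimes> e \<in> I" if "r \<in> carrier R" for r
        using x t that by (simp add: m_assoc[of x t r])
      ultimately show "x \<otimes> t \<in> ?L" using x t by simp
    qed simp
    have IL: "I \<subseteq> ?L"
    proof
      fix x assume x: "x \<in> I"
      then have xc: "x \<in> carrier R" "e \<otimes> x = x" "x \<otimes> e = x" using Ic(1) by auto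
      have "x \<otimes> r \<otimes> e \<in> I" if r: "r \<in> carrier R" for r
      proof -
        have "x \<otimes> (e \<otimes> r \<otimes> e) = (x \<otimes> e) \<otimes> r \<otimes> e" using xc(1) r by (simp add: m_assoc)
        then have "x \<otimes> r \<otimes> e = x \<otimes> (e \<otimes> r \<otimes> e)" using xc(3) by simp
        then show ?thesis using Ic(4)[OF x, of "e \<otimes> r \<otimes> e"] ere[OF r] r by simp
      qed
      then show "x \<in> ?L" using xc by simp
    qed
    show "\<exists>d\<in>carrier (corner R e). I = d <#\<^bsub>corner R e\<^esub> carrier (corner R e)"
    proof (cases "?L = {\<zero>}")
      case True
      have "I = {\<zero>}" using IL Ic(2) unfolding True by auto
      moreover have "\<zero> <#\<^bsub>corner R e\<^esub> carrier (corner R e) = {\<zero>}"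
        using C.zero_closed by (auto simp: l_coset_def)
      ultimately show ?thesis using C.zero_closed by (intro bexI[of _ \<zero>]) auto
    next
      case False
      have "?L \<subseteq> e <# carrier R"
      proof
        fix x assume "x \<in> ?L"
        then have "x \<in> carrier R" "x = e \<otimes> x" by auto
        then show "x \<in> e <# carrier R" unfolding l_coset_def by blast
      qed
      from isosimple[OF L this False]
      obtain d where d: "d \<in> ?L" "d \<otimes> e = d" "?L = d <# carrier R" by blast
      then have dc: "d \<in> carrier R" "e \<otimes> d = d" by auto
      \<comment> \<open>The instance \<open>r = \<one>\<close> of the condition defining
        \<open>?L\<close> puts the generator itself into \<open>I\<close>.\<close>
      have "d \<otimes> \<one> \<otimes> e \<in> I" using d(1) by blast
      then have dI: "d \<in> I" using dc d(2) by simp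
      have "I = d <#\<^bsub>corner R e\<^esub> carrier (corner R e)"
      proof
        show "d <#\<^bsub>corner R e\<^esub> carrier (corner R e) \<subseteq> I" using Ic(4)[OF dI] by (auto simp: l_coset_def)
        show "I \<subseteq> d <#\<^bsub>corner R e\<^esub> carrier (corner R e)"
        proof
          fix x assume x: "x \<in> I"
          then have "x \<in> d <# carrier R" using IL d(3) by blast
          then obtain r where r: "r \<in> carrier R" "x = d \<otimes> r" by (auto simp: l_coset_def)
          have "d \<otimes> (e \<otimes> r \<otimes> e) = (d \<otimes> e) \<otimes> r \<otimes> e" using dc r(1) by (simp add: m_assoc)
          also have "\<dots> = x \<otimes> e" using d(2) r by simp
          also have "\<dots> = x" using Ic(1)[OF x] by simp
          finally have "x = d \<otimes>\<^bsub>corner R e\<^esub> (e \<otimes> r \<otimes> e)" by simp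
          moreover have "e \<otimes> r \<otimes> e \<in> carrier (corner R e)" using ere[OF r(1)] r by simp
          ultimately show "x \<in> d <#\<^bsub>corner R e\<^esub> carrier (corner R e)" unfolding l_coset_def by blast
        qed
      qed
      then show ?thesis using dc d(2) by auto
    qed
  qed
qed

end

section \<open>Simple right isoartinian rings\<close>

context ring
begin

definition isosimple_ideal :: "'a set \<Rightarrow> bool" where
  "isosimple_ideal U \<longleftrightarrow> right_ideal U R \<and> U \<noteq> {\<zero>} \<and>
     (\<forall>V. right_ideal V R \<longrightarrow> V \<subseteq> U \<longrightarrow> V \<noteq> {\<zero>} \<longrightarrow> U \<sim>\<^sub>R V)"

lemma right_isoartinianD:
  assumes "right_isoartinian R" "\<And>i. right_ideal (N i) R" "\<And>i. N (Suc i) \<subseteq> N i"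
  shows "\<exists>m. \<forall>i\<ge>m. N i \<sim>\<^sub>R N m"
  using assms unfolding right_isoartinian_def isoartinian_module_def right_ideal_def by blast

text \<open>Otherwise each nonzero right ideal contains a nonzero one not isomorphic to it, and
  dependent choice produces a descending chain whose consecutive terms are never isomorphic.\<close>

lemma exists_isosimple_ideal:
  assumes iso: "right_isoartinian R" and nz: "carrier R \<noteq> {\<zero>}"
  shows "\<exists>U. isosimple_ideal U"
proof (rule ccontr)
  assume none: "\<nexists>U. isosimple_ideal U"
  have "\<exists>N. \<forall>i::nat. (right_ideal (N i) R \<and> N i \<noteq> {\<zero>}) \<and> (N (Suc i) \<subseteq> N i \<and> \<not> N i \<sim>\<^sub>R N (Suc i))"
  proof (rule dependent_nat_choice)
    show "\<exists>N. right_ideal N R \<and> N \<noteq> {\<zero>}" using right_ideal_carrier nz by blast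
    fix N and i :: nat assume "right_ideal N R \<and> N \<noteq> {\<zero>}"
    then show "\<exists>V. (right_ideal V R \<and> V \<noteq> {\<zero>}) \<and> V \<subseteq> N \<and> \<not> N \<sim>\<^sub>R V"
      using none unfolding isosimple_ideal_def by blast
  qed
  then obtain N where N: "\<And>i::nat. right_ideal (N i) R" "\<And>i. N (Suc i) \<subseteq> N i"
    "\<And>i. \<not> N i \<sim>\<^sub>R N (Suc i)" by blast
  obtain m where "\<forall>i\<ge>m. N i \<sim>\<^sub>R N m" using right_isoartinianD[of N, OF iso N(1,2)] by blast
  then have "N (Suc m) \<sim>\<^sub>R N m" by simp
  then show False using iso_right_sym N(1,3) by blast
qed

text \<open>The elements killing the common right annihilator of some finite subset of
  \<open>U\<close> form a two-sided ideal containing \<open>U\<close>. By simplicity it contains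
  one.\<close>

lemma finite_zero_annihilator:
  assumes simple: "simple_ring R" and U: "right_ideal U R" "U \<noteq> {\<zero>}"
  shows "\<exists>F. finite F \<and> F \<subseteq> U \<and> (\<forall>x\<in>carrier R. (\<forall>u\<in>F. u \<otimes> x = \<zero>) \<longrightarrow> x = \<zero>)"
proof -
  note Uc = right_idealD[OF U(1)]
  define P where "P F t \<longleftrightarrow> finite F \<and> F \<subseteq> U \<and>
    (\<forall>x\<in>carrier R. (\<forall>u\<in>F. u \<otimes> x = \<zero>) \<longrightarrow> t \<otimes> x = \<zero>)" for F t
  let ?T = "{t \<in> carrier R. \<exists>F. P F t}"
  have UT: "U \<subseteq> ?T"
  proof
    fix u assume "u \<in> U"
    then have "P {u} u" "u \<in> carrier R" using Uc by (auto simp: P_def)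
    then show "u \<in> ?T" by blast
  qed
  have "ideal ?T R"
    unfolding ideal_iff
  proof (intro conjI ballI right_idealI)
    show "\<zero> \<in> ?T" using UT Uc(2) by blast
  next
    fix s t assume "s \<in> ?T" "t \<in> ?T"
    then obtain F G where FG: "s \<in> carrier R" "P F s" "t \<in> carrier R" "P G t" by blast
    then have "P (F \<union> G) (s \<oplus> t)" by (auto simp: P_def l_distr)
    then show "s \<oplus> t \<in> ?T" using FG by blast
  next
    fix t r assume "t \<in> ?T" and r: "r \<in> carrier R"
    then obtain F where F: "t \<in> carrier R" "P F t" by blast
    have "P F (r \<otimes> t)" using F r by (auto simp: P_def m_assoc)
    then show "r \<otimes> t \<in> ?T" using F r by blast
    \<comment> \<open>For \<open>t \<otimes> r\<close> the finite set is multiplied by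
      \<open>r\<close>, which stays inside the right ideal \<open>U\<close>: if
      \<open>u \<otimes> r\<close> kills \<open>x\<close>, then \<open>u\<close> kills
      \<open>r \<otimes> x\<close>.\<close>
    have "P ((\<lambda>u. u \<otimes> r) ` F) (t \<otimes> r)"
      unfolding P_def
    proof (intro conjI ballI impI)
      show "finite ((\<lambda>u. u \<otimes> r) ` F)" using F by (simp add: P_def)
      show "(\<lambda>u. u \<otimes> r) ` F \<subseteq> U" using F r Uc by (auto simp: P_def)
      fix x assume x: "x \<in> carrier R" "\<forall>u\<in>(\<lambda>u. u \<otimes> r) ` F. u \<otimes> x = \<zero>"
      have "u \<otimes> (r \<otimes> x) = \<zero>" if "u \<in> F" for u
      proof -
        have "u \<in> carrier R" using that F Uc by (auto simp: P_def)
        then show ?thesis using x that r by (simp flip: m_assoc)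
      qed
      then have "t \<otimes> (r \<otimes> x) = \<zero>" using F x r unfolding P_def by blast
      then show "t \<otimes> r \<otimes> x = \<zero>" using F x r by (simp add: m_assoc)
    qed
    then show "t \<otimes> r \<in> ?T" using F r by blast
  qed auto
  moreover have "?T \<noteq> {\<zero>}" using UT U Uc(2) by blast
  ultimately have "?T = carrier R" using simple unfolding simple_ring_def by blast
  then have "\<one> \<in> ?T" by simp
  then obtain F where "P F \<one>" by blast
  then show ?thesis by (intro exI[of _ F]) (auto simp: P_def)
qed

text \<open>A set of least cardinality with zero common annihilator is enumerated; omitting any one
  element leaves a nonzero annihilator.\<close>

lemma minimal_zero_annihilator:
  assumes "simple_ring R" "right_ideal U R" "U \<noteq> {\<zero>}"
  obtains n :: nat and u where "\<And>i. i < n \<Longrightarrow> u i \<in> U"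
    "\<And>x. x \<in> carrier R \<Longrightarrow> (\<And>i. i < n \<Longrightarrow> u i \<otimes> x = \<zero>) \<Longrightarrow> x = \<zero>"
    "\<And>i. i < n \<Longrightarrow> \<exists>x\<in>carrier R. x \<noteq> \<zero> \<and> (\<forall>j<n. j \<noteq> i \<longrightarrow> u j \<otimes> x = \<zero>)"
proof -
  define P where "P F \<longleftrightarrow> finite F \<and> F \<subseteq> U \<and>
    (\<forall>x\<in>carrier R. (\<forall>u\<in>F. u \<otimes> x = \<zero>) \<longrightarrow> x = \<zero>)" for F
  obtain F0 where "P F0" using finite_zero_annihilator[OF assms] unfolding P_def by blast
  then obtain F where F: "P F" "\<And>G. P G \<Longrightarrow> card F \<le> card G"
    using ex_has_least_nat[of P F0 card] by blast
  obtain u where u: "bij_betw u {0..<card F} F"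
    using ex_bij_betw_nat_finite F(1) unfolding P_def by blast
  have uF: "u i \<in> F" if "i < card F" for i using u that by (auto simp: bij_betw_def)
  have surj: "\<exists>i<card F. v = u i" if "v \<in> F" for v
    using that u unfolding bij_betw_def by (metis atLeastLessThan_iff imageE)
  show thesis
  proof (rule that[of "card F" u])
    show "u i \<in> U" if "i < card F" for i using uF[OF that] F(1) by (auto simp: P_def)
    show "x = \<zero>" if "x \<in> carrier R" "\<And>i. i < card F \<Longrightarrow> u i \<otimes> x = \<zero>" for x
    proof -
      have "\<forall>v\<in>F. v \<otimes> x = \<zero>" using that(2) surj by blast
      then show ?thesis using F(1) that(1) unfolding P_def by blast
    qed
    fix i assume i: "i < card F"
    have fin: "finite F" using F(1) by (simp add: P_def)
    have "card (F - {u i}) < card F" using card_Diff1_less[OF fin uF[OF i]] .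
    then have "\<not> P (F - {u i})" using F(2) by force
    then obtain x where x: "x \<in> carrier R" "x \<noteq> \<zero>" "\<forall>v\<in>F - {u i}. v \<otimes> x = \<zero>"
      using F(1) unfolding P_def by blast
    have "u j \<otimes> x = \<zero>" if "j < card F" "j \<noteq> i" for j
    proof -
      have "u j \<noteq> u i" using u that i by (auto simp: bij_betw_def inj_on_def)
      then show ?thesis using x(3) uF[OF that(1)] by blast
    qed
    then show "\<exists>x\<in>carrier R. x \<noteq> \<zero> \<and> (\<forall>j<card F. j \<noteq> i \<longrightarrow> u j \<otimes> x = \<zero>)"
      using x by blast
  qed
qed

text \<open>
  In the chain \<open>R \<supseteq> J \<supseteq> c R \<supseteq> c J \<supseteq> c\<^sup>2 R \<supseteq> \<dots>\<close> the terms are alternately isomorphic to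
  \<open>R\<close> and to \<open>J\<close>.
\<close>

lemma iso_right_carrier:
  assumes iso: "right_isoartinian R" and J: "right_ideal J R"
    and c: "c \<in> J" "\<And>x. x \<in> carrier R \<Longrightarrow> c \<otimes> x = \<zero> \<Longrightarrow> x = \<zero>"
  shows "J \<sim>\<^sub>R carrier R"
proof -
  note Jc = right_idealD[OF J]
  have cc: "c \<in> carrier R" using c Jc by blast
  have pow_inj: "x = \<zero>" if "x \<in> carrier R" "c [^] i \<otimes> x = \<zero>" for i :: nat and x
    using that
  proof (induction i arbitrary: x)
    case (Suc i)
    have "c [^] i \<otimes> (c \<otimes> x) = \<zero>" using Suc.prems cc by (simp add: m_assoc)
    then have "c \<otimes> x = \<zero>" by (rule Suc.IH[rotated]) (simp add: Suc.prems cc)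
    then show ?case by (rule c(2)[OF Suc.prems(1)])
  qed simp
  \<comment> \<open>Terms with even index \<open>2 i\<close> are \<open>c\<^sup>i R\<close> and
    those with odd index \<open>2 i + 1\<close> are \<open>c\<^sup>i J\<close>.\<close>
  define N where "N k = (\<lambda>x. c [^] (k div 2) \<otimes> x) ` (if even k then carrier R else J)" for k :: nat
  have lin: "right_linear I (\<lambda>x. c [^] i \<otimes> x)" if "right_ideal I R" for I and i :: nat
    using right_idealD(1)[OF that] cc by (intro right_linear_mult) auto
  have N_ri: "right_ideal (N k) R" for k
    unfolding N_def using J right_ideal_carrier by (intro right_linear_image lin) auto
  have "N (Suc k) \<subseteq> N k" for k
  proof (cases "even k")
    case True
    then have "Suc k div 2 = k div 2" by simp
    then show ?thesis using True Jc by (auto simp: N_def)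
  next
    case False
    have "c [^] (Suc k div 2) \<otimes> x \<in> N k" if x: "x \<in> carrier R" for x
    proof -
      have "Suc k div 2 = Suc (k div 2)" using False by simp
      then have "c [^] (Suc k div 2) \<otimes> x = c [^] (k div 2) \<otimes> (c \<otimes> x)" using cc x by (simp add: m_assoc)
      then show ?thesis using Jc(4)[OF c(1) x] False by (auto simp: N_def)
    qed
    then show ?thesis using False by (auto simp: N_def)
  qed
  from right_isoartinianD[of N, OF iso N_ri this]
  obtain m where m: "\<forall>i\<ge>m. N i \<sim>\<^sub>R N m" by blast
  have im: "I \<sim>\<^sub>R (\<lambda>x. c [^] i \<otimes> x) ` I" if "right_ideal I R" for I and i :: nat
    using right_idealD(1)[OF that] pow_inj by (intro iso_right_image that lin) blast
  \<comment> \<open>The indices \<open>2 m\<close> and \<open>2 m + 1\<close> have both parities and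
    are at least \<open>m\<close>, so \<open>N m\<close> links \<open>R\<close> with
    \<open>J\<close> whatever the parity of \<open>m\<close>.\<close>
  have "carrier R \<sim>\<^sub>R N (2 * m)" using im[OF right_ideal_carrier, of m] by (simp add: N_def)
  also have "N (2 * m) \<sim>\<^sub>R N m" using m by simp
  finally (iso_right_trans) have R: "carrier R \<sim>\<^sub>R N m" .
  have "J \<sim>\<^sub>R N (Suc (2 * m))" using im[OF J, of m] by (simp add: N_def)
  also have "N (Suc (2 * m)) \<sim>\<^sub>R N m" using m by simp
  also (iso_right_trans) have "N m \<sim>\<^sub>R carrier R"
    using iso_right_sym[OF right_ideal_carrier N_ri R] .
  finally (iso_right_trans) show ?thesis .
qed

section \<open>Frames from decompositions of the ring into isosimple right ideals\<close>

lemma right_linear_finsum: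
  assumes J: "right_ideal J R" and f: "right_linear J f"
    and "finite A" "\<And>i. i \<in> A \<Longrightarrow> z i \<in> J"
  shows "f (finsum R z A) = (\<Oplus>i\<in>A. f (z i))"
  using assms(3,4)
proof (induction A rule: finite_induct)
  case empty
  then show ?case using right_linear_zero[OF J f] by simp
next
  case (insert x F)
  note Jc = right_idealD[OF J] and fc = right_linearD[OF f]
  have zF: "finsum R z F \<in> J" using insert by (intro right_ideal_finsum[OF J]) auto
  have "finsum R z (insert x F) = z x \<oplus> finsum R z F"
    using insert Jc by (intro finsum_insert) auto
  then have "f (finsum R z (insert x F)) = f (z x) \<oplus> f (finsum R z F)"
    using fc(2) insert zF by simp
  also have "\<dots> = f (z x) \<oplus> (\<Oplus>i\<in>F. f (z i))" using insert by simp
  also have "\<dots> = (\<Oplus>i\<in>insert x F. f (z i))"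
    using insert fc(1) by (intro finsum_insert[symmetric]) auto
  finally show ?case .
qed

text \<open>The assumptions present \<open>R\<close> as an internal direct sum of \<open>n\<close>
  copies of \<open>U\<close>, embedded by the maps \<open>s i\<close>. The frame consists of the
  projection onto the copy with index \<open>0\<close> and the transition maps to and from the other
  copies, all realised as left multiplications.\<close>

lemma matrix_frame_from_decomposition:
  assumes U: "right_ideal U R" and s: "\<And>i. i < n \<Longrightarrow> right_linear U (s i)" and n: "1 \<le> n"
    and gen: "\<And>x. x \<in> carrier R \<Longrightarrow> \<exists>y. (\<forall>i<n. y i \<in> U) \<and> x = (\<Oplus>i\<in>{..<n}. s i (y i))"
    and uniq: "\<And>y z i. \<lbrakk>\<And>i. i < n \<Longrightarrow> y i \<in> U; \<And>i. i < n \<Longrightarrow> z i \<in> U;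
      (\<Oplus>i\<in>{..<n}. s i (y i)) = (\<Oplus>i\<in>{..<n}. s i (z i)); i < n\<rbrakk> \<Longrightarrow> y i = z i"
  obtains a b e where "matrix_frame R n a b e" "e <# carrier R = s 0 ` U"
proof -
  note Uc = right_idealD[OF U]
  have sc: "s i y \<in> carrier R" if "i < n" "y \<in> U" for i y
    using right_linearD(1)[OF s] that by blast
  have s_mult: "s i (y \<otimes> r) = s i y \<otimes> r" if "i < n" "y \<in> U" "r \<in> carrier R" for i y r
    using right_linearD(3)[OF s] that by blast
  have s_zero: "s i \<zero> = \<zero>" if "i < n" for i using right_linear_zero[OF U s] that by blast
  obtain w where w: "\<And>i. i < n \<Longrightarrow> w i \<in> U" "\<one> = (\<Oplus>i\<in>{..<n}. s i (w i))"
    using gen[OF one_closed] by blast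
  have wc: "w i \<in> carrier R" if "i < n" for i using w(1) Uc(1) that by blast
  have expand: "x = (\<Oplus>i\<in>{..<n}. s i (w i \<otimes> x))" if x: "x \<in> carrier R" for x
  proof -
    have "x = \<one> \<otimes> x" using x by simp
    also have "\<dots> = (\<Oplus>i\<in>{..<n}. s i (w i)) \<otimes> x" by (simp only: w(2))
    also have "\<dots> = (\<Oplus>i\<in>{..<n}. s i (w i) \<otimes> x)" using sc w x by (intro finsum_ldistr) auto
    also have "\<dots> = (\<Oplus>i\<in>{..<n}. s i (w i \<otimes> x))"
      using sc s_mult w x by (intro finsum_cong') auto
    finally show ?thesis .
  qed
  \<comment> \<open>Left multiplication by \<open>w i\<close> is the coordinate map onto the copy
    \<open>i\<close> of \<open>U\<close>: both sides are coordinates of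
    \<open>s j y\<close>.\<close>
  have w_s: "w i \<otimes> s j y = (if i = j then y else \<zero>)" if ij: "i < n" "j < n" and y: "y \<in> U" for i j y
  proof (rule uniq[of "\<lambda>i. w i \<otimes> s j y" "\<lambda>i. if i = j then y else \<zero>"])
    show "w i \<otimes> s j y \<in> U" if "i < n" for i using w(1) Uc(4) sc ij y that by blast
    show "(if i = j then y else \<zero>) \<in> U" for i using y Uc(2) by simp
    have "(\<Oplus>i\<in>{..<n}. s i (if i = j then y else \<zero>)) = (\<Oplus>i\<in>{..<n}. if i = j then s j y else \<zero>)"
      using s_zero sc ij y by (intro finsum_cong') auto
    also have "\<dots> = s j y" using sc ij y by (intro finsum_delta) auto
    finally show "(\<Oplus>i\<in>{..<n}. s i (w i \<otimes> s j y)) = (\<Oplus>i\<in>{..<n}. s i (if i = j then y else \<zero>))"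
      using expand[OF sc[OF ij(2) y]] by simp
  qed (use ij in auto)
  have n0: "0 < n" using n by simp
  \<comment> \<open>With these choices
    \<open>b i \<otimes> a j = s 0 (w i \<otimes> s j (w 0))\<close> is \<open>e\<close> or zero,
    and \<open>a i \<otimes> b i = s i (w i)\<close>, so the latter products add up to one.\<close>
  let ?e = "s 0 (w 0)" and ?a = "\<lambda>i. s i (w 0)" and ?b = "\<lambda>i. s 0 (w i)"
  have s_s: "s k (w i) \<otimes> s j y = s k (if i = j then y else \<zero>)"
    if "k < n" "i < n" "j < n" "y \<in> U" for k i j y
    using s_mult[of k "w i" "s j y"] w_s[of i j y] that w sc by simp
  have "matrix_frame R n ?a ?b ?e"
  proof unfold_locales
    show "(\<Oplus>i\<in>{..<n}. ?a i \<otimes> ?b i) = \<one>"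
    proof -
      have "(\<Oplus>i\<in>{..<n}. ?a i \<otimes> ?b i) = (\<Oplus>i\<in>{..<n}. s i (w i))"
        using s_s sc w n0 by (intro finsum_cong') auto
      then show ?thesis using w by simp
    qed
  qed (use sc w n0 s_s s_zero in auto)
  moreover have "?e <# carrier R = s 0 ` U"
  proof
    show "?e <# carrier R \<subseteq> s 0 ` U"
    proof
      fix x assume "x \<in> ?e <# carrier R"
      then obtain r where r: "r \<in> carrier R" "x = ?e \<otimes> r" by (auto simp: l_coset_def)
      then have "x = s 0 (w 0 \<otimes> r)" using s_mult n0 w by simp
      then show "x \<in> s 0 ` U" using Uc(4) w n0 r by blast
    qed
    show "s 0 ` U \<subseteq> ?e <# carrier R"
    proof
      fix x assume "x \<in> s 0 ` U"
      then obtain y where "y \<in> U" "x = s 0 y" by blast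
      then have "x = ?e \<otimes> x" "x \<in> carrier R" using s_s[of 0 0 0 y] n0 sc by auto
      then show "x \<in> ?e <# carrier R" unfolding l_coset_def by blast
    qed
  qed
  ultimately show thesis by (rule that)
qed

text \<open>A submodule of the image is isomorphic to its preimage in \<open>U\<close>, hence to
  \<open>U\<close> and to the image.\<close>

lemma isosimple_ideal_image:
  assumes U: "isosimple_ideal U" and f: "right_linear U f"
    and inj: "\<And>x. x \<in> U \<Longrightarrow> f x = \<zero> \<Longrightarrow> x = \<zero>"
  shows "isosimple_ideal (f ` U)"
  unfolding isosimple_ideal_def
proof (intro conjI allI impI)
  have Ur: "right_ideal U R" and Unz: "U \<noteq> {\<zero>}" using U by (auto simp: isosimple_ideal_def)
  note Uc = right_idealD[OF Ur] and fc = right_linearD[OF f]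
  show fU: "right_ideal (f ` U) R" by (rule right_linear_image) fact+
  show "f ` U \<noteq> {\<zero>}" using Unz inj Uc(2) by auto
  fix V assume V: "right_ideal V R" "V \<subseteq> f ` U" "V \<noteq> {\<zero>}"
  note Vc = right_idealD[OF V(1)]
  let ?W = "{x \<in> U. f x \<in> V}"
  have W: "right_ideal ?W R"
    using Uc Vc fc right_linear_zero[OF Ur f] by (intro right_idealI) auto
  have fW: "f ` ?W = V" using V(2) by auto
  have "?W \<noteq> {\<zero>}"
  proof
    assume "?W = {\<zero>}"
    then have "V = {f \<zero>}" using fW by simp
    then show False using V(3) right_linear_zero[OF Ur f] by simp
  qed
  then have "U \<sim>\<^sub>R ?W" using U W unfolding isosimple_ideal_def by blast
  moreover have "?W \<sim>\<^sub>R V"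
  proof -
    have "right_linear ?W f" using fc by (auto simp: right_linear_def)
    then have "?W \<sim>\<^sub>R f ` ?W" using inj by (intro iso_right_image[OF W]) auto
    then show ?thesis by (simp only: fW)
  qed
  moreover have "f ` U \<sim>\<^sub>R U"
    using iso_right_sym[OF Ur fU iso_right_image[OF Ur f inj]] by blast
  ultimately show "f ` U \<sim>\<^sub>R V" using iso_right_trans by blast
qed

text \<open>An isomorphism from \<open>e R\<close> onto \<open>L\<close> is left multiplication by
  the image of \<open>e\<close>. That image is the required generator, and injectivity is the
  annihilator condition.\<close>

lemma isosimple_frameI:
  assumes "matrix_frame R n a b e" and U: "isosimple_ideal (e <# carrier R)"
  shows "isosimple_frame R n a b e"
proof -
  interpret matrix_frame R n a b e by fact
  show ?thesis
  proof unfold_locales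
    fix L assume L: "right_ideal L R" "L \<subseteq> e <# carrier R" "L \<noteq> {\<zero>}"
    note Lc = right_idealD[OF L(1)]
    have Lsub: "L \<subseteq> carrier R" using Lc by blast
    have "e <# carrier R \<sim>\<^sub>R L" using U L unfolding isosimple_ideal_def by blast
    then obtain f where f: "bij_betw f (e <# carrier R) L" "right_linear (e <# carrier R) f"
      using iso_right_iff[OF Lsub] by blast
    have mem: "e \<otimes> r \<in> e <# carrier R" if "r \<in> carrier R" for r
      using that unfolding l_coset_def by blast
    have e_mem: "e \<in> e <# carrier R" using mem[of \<one>] by simp
    have fe: "f (e \<otimes> r) = f e \<otimes> r" if "r \<in> carrier R" for r
      using right_linearD(3)[OF f(2) e_mem that] .
    have feL: "f e \<in> L" using f(1) e_mem by (auto simp: bij_betw_def)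
    have "f e \<otimes> e = f e" using fe[of e] by (simp add: e_idem)
    moreover have "L = f e <# carrier R"
    proof
      show "f e <# carrier R \<subseteq> L" using feL Lc(4) by (auto simp: l_coset_def)
      show "L \<subseteq> f e <# carrier R"
      proof
        fix x assume "x \<in> L"
        then obtain z where "z \<in> e <# carrier R" "x = f z" using f(1) by (auto simp: bij_betw_def)
        then obtain r where "r \<in> carrier R" "x = f (e \<otimes> r)" by (auto simp: l_coset_def)
        then show "x \<in> f e <# carrier R" using fe by (auto simp: l_coset_def)
      qed
    qed
    moreover have "e \<otimes> y = \<zero>" if y: "y \<in> carrier R" "f e \<otimes> y = \<zero>" for y
    proof -
      have "\<zero> = f \<zero>"
        using right_linear_zero[OF right_ideal_principal[OF e_closed] f(2)] by simp
      then have "f (e \<otimes> y) = f \<zero>" using fe y by simp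
      then show ?thesis
        using inj_onD[OF bij_betw_imp_inj_on[OF f(1)]] mem[OF y(1)] mem[OF zero_closed] by simp
    qed
    ultimately show "\<exists>d\<in>L. d \<otimes> e = d \<and> L = d <# carrier R \<and>
        (\<forall>y\<in>carrier R. d \<otimes> y = \<zero> \<longrightarrow> e \<otimes> y = \<zero>)"
      using feL by blast
  qed
qed

text \<open>The power \<open>U\<^sup>n\<close> is represented inside \<open>R\<close>, by the image
  \<open>J\<close> of the embedding \<open>\<phi>\<close>. All isomorphisms thus remain between
  right ideals of \<open>R\<close>, where the chain condition applies.\<close>

theorem simple_isoartinian_frame:
  assumes simple: "simple_ring R" and nz: "carrier R \<noteq> {\<zero>}" and iso: "right_isoartinian R"
  obtains n a b e where "n \<ge> 1" "isosimple_frame R n a b e" "e \<noteq> \<zero>"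
proof -
  obtain U where U: "isosimple_ideal U" using exists_isosimple_ideal[OF iso nz] by blast
  then have Ur: "right_ideal U R" and Unz: "U \<noteq> {\<zero>}" by (auto simp: isosimple_ideal_def)
  note Uc = right_idealD[OF Ur]
  obtain n :: nat and u where u: "\<And>i. i < n \<Longrightarrow> u i \<in> U"
    and ann: "\<And>x. x \<in> carrier R \<Longrightarrow> (\<And>i. i < n \<Longrightarrow> u i \<otimes> x = \<zero>) \<Longrightarrow> x = \<zero>"
    and minim: "\<And>i. i < n \<Longrightarrow> \<exists>x\<in>carrier R. x \<noteq> \<zero> \<and> (\<forall>j<n. j \<noteq> i \<longrightarrow> u j \<otimes> x = \<zero>)"
    using minimal_zero_annihilator[OF simple Ur Unz] by blast
  have uc: "u i \<in> carrier R" if "i < n" for i using u Uc(1) that by blast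
  have n: "1 \<le> n"
  proof (rule ccontr)
    assume "\<not> 1 \<le> n"
    then have "x = \<zero>" if "x \<in> carrier R" for x using ann that by simp
    then show False using nz by blast
  qed
  \<comment> \<open>By minimality \<open>K i\<close> is nonzero, and since all \<open>u j\<close>
    together kill only zero, \<open>u i\<close> acts injectively on it. So \<open>K i\<close> is
    isomorphic to a nonzero submodule of \<open>U\<close>, hence to \<open>U\<close>.\<close>
  define K where "K i = {x \<in> carrier R. \<forall>j<n. j \<noteq> i \<longrightarrow> u j \<otimes> x = \<zero>}" for i
  have K: "right_ideal (K i) R" for i
    using uc by (intro right_idealI) (auto simp: K_def r_distr simp flip: m_assoc)
  have K_zero: "x = \<zero>" if "x \<in> K i" "u i \<otimes> x = \<zero>" for x i
    using ann[of x] that by (auto simp: K_def)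
  have "U \<sim>\<^sub>R K i" if i: "i < n" for i
  proof -
    have lin: "right_linear (K i) (\<lambda>x. u i \<otimes> x)"
      using uc[OF i] by (intro right_linear_mult) (auto simp: K_def)
    let ?V = "(\<lambda>x. u i \<otimes> x) ` K i"
    have V: "right_ideal ?V R" by (rule right_linear_image[OF K lin])
    have KV: "K i \<sim>\<^sub>R ?V" using K_zero by (intro iso_right_image[OF K lin]) auto
    have "?V \<subseteq> U" using u[OF i] Uc(4) by (auto simp: K_def)
    moreover have "?V \<noteq> {\<zero>}"
    proof
      assume *: "?V = {\<zero>}"
      obtain x where x: "x \<in> K i" "x \<noteq> \<zero>" using minim[OF i] by (auto simp: K_def)
      then have "u i \<otimes> x = \<zero>" using * by blast
      then show False using K_zero x by blast
    qed
    ultimately have "U \<sim>\<^sub>R ?V" using U V unfolding isosimple_ideal_def by blast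
    then show ?thesis using iso_right_trans iso_right_sym[OF K V KV] by blast
  qed
  then have "\<exists>t. bij_betw t U (K i) \<and> right_linear U t" if "i < n" for i
    using iso_right_iff[of "K i" U] that by (auto simp: K_def)
  then obtain t where t_bij: "\<And>i. i < n \<Longrightarrow> bij_betw (t i) U (K i)"
    and t: "\<And>i. i < n \<Longrightarrow> right_linear U (t i)" by metis
  have tK: "t i y \<in> K i" if "i < n" "y \<in> U" for i y using t_bij that by (auto simp: bij_betw_def)
  have tc: "t i y \<in> carrier R" if "i < n" "y \<in> U" for i y using tK[OF that] by (simp add: K_def)
  have t_zero: "t i \<zero> = \<zero>" if "i < n" for i using right_linear_zero[OF Ur t[OF that]] .
  define \<phi> where "\<phi> y = (\<Oplus>i\<in>{..<n}. t i (y i))" for y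
  have \<phi>c: "\<phi> y \<in> carrier R" if "\<And>i. i < n \<Longrightarrow> y i \<in> U" for y
    unfolding \<phi>_def using tc that by (intro finsum_closed) auto
  \<comment> \<open>All components but the one in \<open>K j\<close> are killed by
    \<open>u j\<close>. Together with \<open>u_t_inj\<close> this makes \<open>\<phi>\<close>
    injective.\<close>
  have u_\<phi>: "u j \<otimes> \<phi> y = u j \<otimes> t j (y j)" if y: "\<And>i. i < n \<Longrightarrow> y i \<in> U" and j: "j < n" for y j
  proof -
    have "u j \<otimes> \<phi> y = (\<Oplus>i\<in>{..<n}. u j \<otimes> t i (y i))"
      unfolding \<phi>_def using tc y uc j by (intro finsum_rdistr) auto
    also have "\<dots> = (\<Oplus>i\<in>{..<n}. if i = j then u j \<otimes> t j (y j) else \<zero>)"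
      using tK[OF _ y] tc y uc j by (intro finsum_cong') (auto simp: K_def)
    also have "\<dots> = u j \<otimes> t j (y j)" using tc y uc j by (intro finsum_delta) auto
    finally show ?thesis .
  qed
  have u_t_inj: "y = z" if y: "y \<in> U" "z \<in> U" and i: "i < n" and eq: "u i \<otimes> t i y = u i \<otimes> t i z" for i y z
  proof -
    have "u i \<otimes> (t i y \<ominus> t i z) = \<zero>"
      using eq tc y i uc by (simp add: minus_eq r_distr r_minus r_neg)
    then have "t i y \<ominus> t i z = \<zero>"
      using K_zero right_idealD(6)[OF K] tK y i by blast
    then have "t i y = t i z" using tc y i by simp
    then show ?thesis using t_bij[OF i] y by (auto simp: bij_betw_def inj_on_def)
  qed
  define J where "J = \<phi> ` {y. \<forall>i<n. y i \<in> U}"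
  have \<phi>J: "\<phi> y \<in> J" if "\<And>i. i < n \<Longrightarrow> y i \<in> U" for y using that by (auto simp: J_def)
  have \<phi>_mult: "\<phi> y \<otimes> r = \<phi> (\<lambda>i. y i \<otimes> r)" if y: "\<And>i. i < n \<Longrightarrow> y i \<in> U" and r: "r \<in> carrier R" for y r
  proof -
    have "\<phi> y \<otimes> r = (\<Oplus>i\<in>{..<n}. t i (y i) \<otimes> r)"
      unfolding \<phi>_def using tc y r by (intro finsum_ldistr) auto
    also have "\<dots> = \<phi> (\<lambda>i. y i \<otimes> r)"
      unfolding \<phi>_def using tc y r right_linearD(3)[OF t] Uc(4) by (intro finsum_cong') auto
    finally show ?thesis .
  qed
  have J: "right_ideal J R"
  proof (rule right_idealI)
    show "x \<in> carrier R" if "x \<in> J" for x using that \<phi>c by (auto simp: J_def)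
    have "\<phi> (\<lambda>_. \<zero>) = (\<Oplus>i\<in>{..<n}. \<zero>)" unfolding \<phi>_def using t_zero by (intro finsum_cong') auto
    then have "\<phi> (\<lambda>_. \<zero>) = \<zero>" by simp
    then show "\<zero> \<in> J" using \<phi>J[of "\<lambda>_. \<zero>"] Uc(2) by simp
  next
    fix x x' assume "x \<in> J" "x' \<in> J"
    then obtain y y' where y: "x = \<phi> y" "\<And>i. i < n \<Longrightarrow> y i \<in> U" "x' = \<phi> y'" "\<And>i. i < n \<Longrightarrow> y' i \<in> U"
      by (auto simp: J_def)
    have "x \<oplus> x' = (\<Oplus>i\<in>{..<n}. t i (y i) \<oplus> t i (y' i))"
      unfolding y(1,3) \<phi>_def using tc y by (intro finsum_addf[symmetric]) auto
    also have "\<dots> = \<phi> (\<lambda>i. y i \<oplus> y' i)"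
      unfolding \<phi>_def using tc y right_linearD(2)[OF t] Uc(3) by (intro finsum_cong') auto
    finally show "x \<oplus> x' \<in> J" using \<phi>J[of "\<lambda>i. y i \<oplus> y' i"] y Uc(3) by simp
  next
    fix x r assume x: "x \<in> J" and r: "r \<in> carrier R"
    then obtain y where y: "x = \<phi> y" "\<And>i. i < n \<Longrightarrow> y i \<in> U" by (auto simp: J_def)
    have "x \<otimes> r = \<phi> (\<lambda>i. y i \<otimes> r)" using \<phi>_mult y r by simp
    then show "x \<otimes> r \<in> J" using \<phi>J[of "\<lambda>i. y i \<otimes> r"] y r Uc(4) by simp
  qed
  have "J \<sim>\<^sub>R carrier R"
  proof (rule iso_right_carrier[OF iso J])
    \<comment> \<open>Left multiplication by \<open>\<phi> u\<close> is the embedding of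
      \<open>R\<close> into \<open>U\<^sup>n\<close> with components \<open>u i \<otimes> x\<close>,
      followed by \<open>\<phi>\<close>. Being injective, it supplies the element demanded by
      \<open>iso_right_carrier\<close>.\<close>
    show "\<phi> u \<in> J" using \<phi>J u by blast
    fix x assume x: "x \<in> carrier R" "\<phi> u \<otimes> x = \<zero>"
    have ux: "u i \<otimes> x \<in> U" if "i < n" for i using u Uc(4) x that by blast
    show "x = \<zero>"
    proof (rule ann[OF x(1)])
      fix i assume i: "i < n"
      have "\<phi> (\<lambda>i. u i \<otimes> x) = \<zero>" using \<phi>_mult[of u x] u x by simp
      moreover have "u i \<otimes> \<phi> (\<lambda>i. u i \<otimes> x) = u i \<otimes> t i (u i \<otimes> x)"
        by (rule u_\<phi>[OF ux i])
      ultimately have "u i \<otimes> t i (u i \<otimes> x) = u i \<otimes> t i \<zero>"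
        using t_zero[OF i] by metis
      then show "u i \<otimes> x = \<zero>" using u_t_inj[OF ux Uc(2)] i by blast
    qed
  qed
  then obtain g where g_bij: "bij_betw g J (carrier R)" and g: "right_linear J g"
    using iso_right_iff[of "carrier R" J] by blast
  have tJ: "t i y \<in> J" if i: "i < n" and y: "y \<in> U" for i y
  proof -
    have "\<phi> (\<lambda>j. if j = i then y else \<zero>) = (\<Oplus>j\<in>{..<n}. if j = i then t i y else \<zero>)"
      unfolding \<phi>_def using tc t_zero i y by (intro finsum_cong') auto
    also have "\<dots> = t i y" using tc i y by (intro finsum_delta) auto
    finally show ?thesis using \<phi>J[of "\<lambda>j. if j = i then y else \<zero>"] y Uc(2) by simp
  qed
  \<comment> \<open>Composing with the isomorphism \<open>g\<close> from \<open>J\<close> onto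
    \<open>R\<close> turns the decomposition of \<open>J\<close> into one of
    \<open>R\<close>.\<close>
  define s where "s i y = g (t i y)" for i y
  have g_\<phi>: "g (\<phi> y) = (\<Oplus>i\<in>{..<n}. s i (y i))" if "\<And>i. i < n \<Longrightarrow> y i \<in> U" for y
    unfolding \<phi>_def s_def using tJ that by (intro right_linear_finsum[OF J g]) auto
  have s: "right_linear U (s i)" if i: "i < n" for i
    unfolding right_linear_def s_def
    using right_linearD[OF g] right_linearD(2,3)[OF t] tJ i by auto
  \<comment> \<open>Injectivity of the copy with index \<open>0\<close> is what carries
    isosimplicity from \<open>U\<close> to its image \<open>e R\<close>.\<close>
  have s_zero: "y = \<zero>" if "y \<in> U" "s 0 y = \<zero>" for y
  proof -
    have n0: "0 < n" using n by simp
    have "g (t 0 y) = g \<zero>" using that right_linear_zero[OF J g] by (simp add: s_def)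
    then have "t 0 y = \<zero>"
      using inj_onD[OF bij_betw_imp_inj_on[OF g_bij]] tJ n0 that right_idealD(2)[OF J] by blast
    then have "t 0 y = t 0 \<zero>" using t_zero n0 by simp
    then show ?thesis using t_bij[OF n0] that Uc(2) by (auto simp: bij_betw_def inj_on_def)
  qed
  obtain a b e where abe: "matrix_frame R n a b e" "e <# carrier R = s 0 ` U"
  proof (rule matrix_frame_from_decomposition[OF Ur s n])
    fix x assume "x \<in> carrier R"
    then obtain y where "\<And>i. i < n \<Longrightarrow> y i \<in> U" "x = g (\<phi> y)"
      using g_bij by (auto simp: bij_betw_def J_def)
    then show "\<exists>y. (\<forall>i<n. y i \<in> U) \<and> x = (\<Oplus>i\<in>{..<n}. s i (y i))" using g_\<phi> by metis
  next
    fix y z i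
    assume y: "\<And>i. i < n \<Longrightarrow> y i \<in> U" and z: "\<And>i. i < n \<Longrightarrow> z i \<in> U"
      and eq: "(\<Oplus>i\<in>{..<n}. s i (y i)) = (\<Oplus>i\<in>{..<n}. s i (z i))" and i: "i < n"
    have "g (\<phi> y) = g (\<phi> z)" using g_\<phi>[of y] g_\<phi>[of z] y z eq by simp
    then have "\<phi> y = \<phi> z"
      using inj_onD[OF bij_betw_imp_inj_on[OF g_bij]] \<phi>J y z by blast
    then show "y i = z i" using u_\<phi>[of y i] u_\<phi>[of z i] y z i u_t_inj by metis
  qed auto
  have "isosimple_ideal (e <# carrier R)"
    unfolding abe(2) using isosimple_ideal_image[OF U] s s_zero n by simp
  moreover from this have "e \<noteq> \<zero>"
  proof (rule contrapos_pn)
    assume "e = \<zero>"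
    then have "e <# carrier R = {\<zero>}" by (auto simp: l_coset_def intro: zero_closed)
    then show "\<not> isosimple_ideal (e <# carrier R)" by (simp add: isosimple_ideal_def)
  qed
  ultimately show thesis using that[OF n] isosimple_frameI[OF abe(1)] by blast
qed

end

text \<open>The ring obtained from an isoartinian \<open>R\<close> is a corner of \<open>R\<close>,
  so it has the same element type. The second conjunct gives the converse and the supplement for
  \<open>D\<close> over an arbitrary type.\<close>

theorem proposition2p25:
  fixes R :: "('a, 'm) ring_scheme"
  assumes "simple_ring R" and "carrier R \<noteq> {\<zero>\<^bsub>R\<^esub>}"
  shows "(right_isoartinian R \<longleftrightarrow>
           (\<exists>n\<ge>1. \<exists>D :: 'a ring.
              principal_right_ideal_domain D \<and> simple_ring D \<and> R \<simeq> matrix_ring n D))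
       \<and> (\<forall>n\<ge>1. \<forall>D :: ('b, 'k) ring_scheme.
            principal_right_ideal_domain D \<and> simple_ring D \<and> R \<simeq> matrix_ring n D \<longrightarrow>
              right_isoartinian R
              \<and> (division_ring D \<longrightarrow>
                  simple_artinian R \<and> right_artinian R \<and> right_noetherian R))"
proof -
  have R: "ring R" using assms(1) by (simp add: simple_ring_def)
  \<comment> \<open>The type of \<open>D\<close> is kept free here and in
    \<open>isoartinian\<close>, which is applied both to a ring over \<open>'a\<close> and to one
    over \<open>'b\<close>.\<close>
  have frame: "\<exists>a b e \<delta>. frame_over R n a b e D \<delta>"
    if "n \<ge> 1" "ring D" "R \<simeq> matrix_ring n D" for n and D :: "('c, 'd) ring_scheme"
  proof -
    obtain h where "h \<in> ring_iso R (matrix_ring n D)"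
      using \<open>R \<simeq> matrix_ring n D\<close> by (auto simp: is_ring_iso_def)
    then show ?thesis
      using frame_over_transport[OF ring.matrix_frame_over[OF \<open>ring D\<close> \<open>n \<ge> 1\<close>] R] by metis
  qed
  have isoartinian: "right_isoartinian R"
    if "n \<ge> 1" "principal_right_ideal_domain D" "R \<simeq> matrix_ring n D" for n and D :: "('c, 'd) ring_scheme"
    using frame[of n D] that frame_over.isosimple_frame isosimple_frame.isoartinian
      principal_right_ideal_domain.axioms(1) by metis
  have division: "simple_artinian R \<and> right_artinian R \<and> right_noetherian R"
    if "n \<ge> 1" "division_ring D" "R \<simeq> matrix_ring n D" for n and D :: "('c, 'd) ring_scheme"
  proof -
    have "ring D" using that by (simp add: division_ring_def)
    from frame[OF that(1) this that(3)] obtain a b e \<delta> where "frame_over R n a b e D \<delta>" by blast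
    then interpret division_frame R n a b e
      by (rule frame_over.division_frame[OF _ that(2)])
    show ?thesis
      using artinian noetherian left_artinian assms(1) by (simp add: simple_artinian_def)
  qed
  have matrix: "\<exists>n\<ge>1. \<exists>D :: 'a ring.
      principal_right_ideal_domain D \<and> simple_ring D \<and> R \<simeq> matrix_ring n D"
    if iso: "right_isoartinian R"
  proof -
    interpret ring R by (rule R)
    obtain n a b e where n: "n \<ge> 1" and f: "isosimple_frame R n a b e" and e: "e \<noteq> \<zero>\<^bsub>R\<^esub>"
      using simple_isoartinian_frame[OF assms iso] by blast
    interpret isosimple_frame R n a b e by (rule f)
    show ?thesis
      using n corner_principal_right_ideal_domain[OF e] corner_simple[OF assms(1)] iso_matrix_ring
      by blast
  qed
  show ?thesis
  proof (rule conjI, rule iffI)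
    show "\<exists>n\<ge>1. \<exists>D :: 'a ring.
        principal_right_ideal_domain D \<and> simple_ring D \<and> R \<simeq> matrix_ring n D"
      if "right_isoartinian R"
      using matrix[OF that] .
    show "right_isoartinian R"
      if "\<exists>n\<ge>1. \<exists>D :: 'a ring.
        principal_right_ideal_domain D \<and> simple_ring D \<and> R \<simeq> matrix_ring n D"
      using that by (elim exE conjE) (rule isoartinian)
    show "\<forall>n\<ge>1. \<forall>D :: ('b, 'k) ring_scheme.
        principal_right_ideal_domain D \<and> simple_ring D \<and> R \<simeq> matrix_ring n D \<longrightarrow>
          right_isoartinian R
          \<and> (division_ring D \<longrightarrow> simple_artinian R \<and> right_artinian R \<and> right_noetherian R)"
    proof (intro allI impI, elim conjE, rule conjI)
      fix n and D :: "('b, 'k) ring_scheme"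
      assume *: "1 \<le> n" "principal_right_ideal_domain D" "R \<simeq> matrix_ring n D"
      show "right_isoartinian R" by (rule isoartinian[OF *])
      show "division_ring D \<longrightarrow> simple_artinian R \<and> right_artinian R \<and> right_noetherian R"
        using division[OF *(1) _ *(3)] by (rule impI)
    qed
  qed
qed

end
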